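(* Let $A=\bigoplus_{i=1}^m B(X_i)$ and $B=\bigoplus_{j=1}^n B(Y_j)$, let $H$ be a finite-dimensional Hilbert space with fixed orthonormal basis $\{|h\rangle\}$, and let $M:A\otimes B(H)\to B$ be a channel with minimal dilation $\tau_{ij}:X_i\otimes H\to Y_j\otimes E_{ji}$. Then $M$ is entanglement-invertible with respect to the canonical maximally entangled state $\Phi_H$ of $H\otimes H$ if and only if both of the following hold: (a) for every $i\in[m]$ the map $U_i:X_i\otimes H\to\bigoplus_{j}(Y_j\otimes E_{ji})$, $\xi\mapsto(\tau_{ij}\xi)_{j}$, is unitary; (b) for every $j\in[n]$ the map $W_j:\bigoplus_i (X_i\otimes E_{ji})\to Y_j\otimes H$, $(\xi_i)_i\mapsto\sum_i\sqrt{\dim X_i/\dim Y_j}\;\tilde\tau_{ij}\xi_i$, is unitary. Moreover, in this case the entanglement-inverse $N:B\otimes B(H)\to A$ is unique and is given by $N\big(\bigoplus_j\rho_j\big)=\bigoplus_i\sum_j \frac{\dim X_i}{\dim Y_j}\,\mathrm{Tr}_{E_{ji}}\big(\tilde\tau_{ij}^\dagger\rho_j\tilde\tau_{ij}\big)$ for $\rho_j\in B(Y_j\otimes H)$.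
   Context: All Hilbert spaces are finite-dimensional. A channel between finite-dimensional $C^*$-algebras is a completely positive trace-preserving linear map (acting on states). Write $A=\bigoplus_{i=1}^m B(X_i)$, $B=\bigoplus_{j=1}^n B(Y_j)$, so $\dim A=\sum_i(\dim X_i)^2$, and identify $A\otimes B(H)=\bigoplus_i B(X_i\otimes H)$. A channel $M:A\otimes B(H)\to B$ has components $M_{ij}:B(X_i\otimes H)\to B(Y_j)$ with $M(\oplus_i\rho_i)=\oplus_j\sum_iM_{ij}(\rho_i)$. A minimal dilation of $M$ is a family of linear maps $\tau_{ij}:X_i\otimes H\to Y_j\otimes E_{ji}$ ($E_{ji}$ Hilbert spaces, possibly zero) with $M_{ij}(\rho)=\mathrm{Tr}_{E_{ji}}(\tau_{ij}\rho\tau_{ij}^\dagger)$ such that, for an orthonormal basis $\{e_k\}$ of $E_{ji}$, the operators $(1_{Y_j}\otimes\langle e_k|)\tau_{ij}$ are linearly independent; trace preservation means $\sum_j\tau_{ij}^\dagger\tau_{ij}=1$ for all $i$. Fix an orthonormal basis $\{|h\rangle\}$ of $H$ and orthonormal bases $\{e_k\}$ of each $E_{ji}$; the partial transpose $\tilde\tau_{ij}:X_i\otimes E_{ji}\to Y_j\otimes H$ is the linear map $\tilde\tau_{ij}(x\otimes e_k)=\sum_h\big[(1_{Y_j}\otimes\langle e_k|)\tau_{ij}(x\otimes |h\rangle)\big]\otimes|h\rangle$. Let $|\eta_H\rangle=\sum_h|h\rangle\otimes|h\rangle$ and let $\Phi_H=|\eta_H\rangle\langle\eta_H|/\dim H$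 be the canonical maximally entangled state. Entanglement-reversibility/invertibility: let $W$ be a state (density operator) on $H_1\otimes H_2$ and $W'$ the same state with tensor factors swapped. A channel $M:A\otimes B(H_1)\to B$ is entanglement-reversible with respect to $W$ if there is a channel $N:B\otimes B(H_2)\to A$ (an entanglement-left inverse) with $N\big((M\otimes\mathrm{id}_{B(H_2)})(\rho\otimes W)\big)=\rho$ for all $\rho\in A$; it is entanglement-invertible with respect to $W$ if moreover $M\big((N\otimes\mathrm{id}_{B(H_1)})(\sigma\otimes W')\big)=\sigma$ for all $\sigma\in B$, and then $N$ is called an entanglement-inverse. Here $H_1=H_2=H$ and $W=\Phi_H$. *)

theory Defs
  imports Complex_Main "Jordan_Normal_Form.Matrix"
begin

text \<open>Tensor product conventions: the basis vector x (x) y of a tensor product X (x) Y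
(with dim Y = dY) has index x * dY + y.\<close>

definition adj :: "complex mat \<Rightarrow> complex mat" where
  "adj A = mat (dim_col A) (dim_row A) (\<lambda>(r, c). cnj (A $$ (c, r)))"

definition mtrace :: "complex mat \<Rightarrow> complex" where
  "mtrace A = (\<Sum>k<dim_row A. A $$ (k, k))"

definition kron :: "complex mat \<Rightarrow> complex mat \<Rightarrow> complex mat" where
  "kron A B = mat (dim_row A * dim_row B) (dim_col A * dim_col B)
     (\<lambda>(r, c). A $$ (r div dim_row B, c div dim_col B) * B $$ (r mod dim_row B, c mod dim_col B))"

definition msum :: "nat \<Rightarrow> nat \<Rightarrow> (nat \<Rightarrow> complex mat) \<Rightarrow> nat \<Rightarrow> complex mat" where
  "msum nr nc f N = mat nr nc (\<lambda>(r, c). \<Sum>k<N. f k $$ (r, c))"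

definition ptrace2 :: "nat \<Rightarrow> nat \<Rightarrow> complex mat \<Rightarrow> complex mat" where
  "ptrace2 dX dE P = mat dX dX (\<lambda>(x, x'). \<Sum>k<dE. P $$ (x * dE + k, x' * dE + k))"

definition psd :: "nat \<Rightarrow> complex mat \<Rightarrow> bool" where
  "psd d P \<longleftrightarrow> P \<in> carrier_mat d d \<and>
     (\<forall>v :: nat \<Rightarrow> complex. let q = (\<Sum>a<d. \<Sum>b<d. cnj (v a) * P $$ (a, b) * v b)
        in Im q = 0 \<and> Re q \<ge> 0)"

definition unitary_mat :: "complex mat \<Rightarrow> bool" where
  "unitary_mat U \<longleftrightarrow> adj U * U = 1\<^sub>m (dim_col U) \<and> U * adj U = 1\<^sub>m (dim_row U)"

text \<open>Block matrices: vertical stacking (direct sum in the codomain) and horizontal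
stacking (direct sum in the domain) of the blocks b 0, ..., b (N-1).\<close>
primrec vstack :: "nat \<Rightarrow> (nat \<Rightarrow> complex mat) \<Rightarrow> nat \<Rightarrow> complex mat" where
  "vstack nc b 0 = 0\<^sub>m 0 nc"
| "vstack nc b (Suc N) = vstack nc b N @\<^sub>r b N"

primrec hstack :: "nat \<Rightarrow> (nat \<Rightarrow> complex mat) \<Rightarrow> nat \<Rightarrow> complex mat" where
  "hstack nr b 0 = 0\<^sub>m nr 0"
| "hstack nr b (Suc N) = four_block_mat (hstack nr b N) (b N) (0\<^sub>m 0 (dim_col (hstack nr b N))) (0\<^sub>m 0 (dim_col (b N)))"

definition blk :: "nat \<Rightarrow> nat \<Rightarrow> complex mat \<Rightarrow> nat \<Rightarrow> nat \<Rightarrow> complex mat" where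
  "blk dA k P h h' = mat dA dA (\<lambda>(a, a'). P $$ (a * k + h, a' * k + h'))"

definition map_tensor_id :: "(complex mat \<Rightarrow> complex mat) \<Rightarrow> nat \<Rightarrow> nat \<Rightarrow> nat \<Rightarrow> complex mat \<Rightarrow> complex mat" where
  "map_tensor_id f dA dB k P = mat (dB * k) (dB * k)
     (\<lambda>(r, c). f (blk dA k P (r mod k) (c mod k)) $$ (r div k, c div k))"

definition lin_map :: "nat \<Rightarrow> nat \<Rightarrow> (complex mat \<Rightarrow> complex mat) \<Rightarrow> bool" where
  "lin_map dA dB f \<longleftrightarrow>
     (\<forall>P \<in> carrier_mat dA dA. f P \<in> carrier_mat dB dB) \<and>
     (\<forall>P \<in> carrier_mat dA dA. \<forall>Q \<in> carrier_mat dA dA. f (P + Q) = f P + f Q) \<and>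
     (\<forall>P \<in> carrier_mat dA dA. \<forall>c. f (c \<cdot>\<^sub>m P) = c \<cdot>\<^sub>m f P)"

definition compl_pos :: "nat \<Rightarrow> nat \<Rightarrow> (complex mat \<Rightarrow> complex mat) \<Rightarrow> bool" where
  "compl_pos dA dB f \<longleftrightarrow>
     (\<forall>k P. psd (dA * k) P \<longrightarrow> psd (dB * k) (map_tensor_id f dA dB k P))"

text \<open>A linear map from (+)_{j<n} B(V_j) (dim V_j = dIn j) to (+)_{i<m} B(W_i) (dim W_i = dOut i)
is given by its components F j i : B(V_j) -> B(W_i), acting by
F((+)_j rho_j) = (+)_i sum_j F j i rho_j. It is a channel iff it is completely positive
(i.e. every component is) and trace preserving.\<close>
definition apply_map :: "nat \<Rightarrow> (nat \<Rightarrow> nat) \<Rightarrow> (nat \<Rightarrow> nat \<Rightarrow> complex mat \<Rightarrow> complex mat)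
     \<Rightarrow> (nat \<Rightarrow> complex mat) \<Rightarrow> (nat \<Rightarrow> complex mat)" where
  "apply_map n dOut F \<rho> = (\<lambda>i. msum (dOut i) (dOut i) (\<lambda>j. F j i (\<rho> j)) n)"

definition is_channel :: "nat \<Rightarrow> (nat \<Rightarrow> nat) \<Rightarrow> nat \<Rightarrow> (nat \<Rightarrow> nat)
     \<Rightarrow> (nat \<Rightarrow> nat \<Rightarrow> complex mat \<Rightarrow> complex mat) \<Rightarrow> bool" where
  "is_channel n dIn m dOut F \<longleftrightarrow>
     (\<forall>j<n. \<forall>i<m. lin_map (dIn j) (dOut i) (F j i) \<and> compl_pos (dIn j) (dOut i) (F j i)) \<and>
     (\<forall>j<n. \<forall>P \<in> carrier_mat (dIn j) (dIn j). (\<Sum>i<m. mtrace (F j i P)) = mtrace P)"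

definition max_ent :: "nat \<Rightarrow> complex mat" where
  "max_ent dH = mat (dH * dH) (dH * dH)
     (\<lambda>(r, c). if r div dH = r mod dH \<and> c div dH = c mod dH then 1 / of_nat dH else 0)"

definition swap_state :: "nat \<Rightarrow> nat \<Rightarrow> complex mat \<Rightarrow> complex mat" where
  "swap_state d1 d2 W = mat (d2 * d1) (d2 * d1)
     (\<lambda>(r, c). W $$ ((r mod d1) * d2 + r div d1, (c mod d1) * d2 + c div d1))"

text \<open>Blocks: A = (+)_{i<m} B(X_i), B = (+)_{j<n} B(Y_j), dX i = dim X_i, dY j = dim Y_j,
dH = dim H, dE j i = dim E_ji; tau i j : X_i (x) H -> Y_j (x) E_ji.\<close>

definition dil_comp :: "(nat \<Rightarrow> nat) \<Rightarrow> (nat \<Rightarrow> nat \<Rightarrow> nat) \<Rightarrow> (nat \<Rightarrow> nat \<Rightarrow> complex mat)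
     \<Rightarrow> nat \<Rightarrow> nat \<Rightarrow> complex mat \<Rightarrow> complex mat" where
  "dil_comp dY dE \<tau> i j \<rho> = ptrace2 (dY j) (dE j i) (\<tau> i j * \<rho> * adj (\<tau> i j))"

definition chanM :: "(nat \<Rightarrow> nat) \<Rightarrow> (nat \<Rightarrow> nat \<Rightarrow> nat) \<Rightarrow> (nat \<Rightarrow> nat \<Rightarrow> complex mat)
     \<Rightarrow> nat \<Rightarrow> nat \<Rightarrow> complex mat \<Rightarrow> complex mat" where
  "chanM dY dE \<tau> = (\<lambda>i j. dil_comp dY dE \<tau> i j)"

text \<open>Minimality: the operators (1 (x) <e_k|) tau, k < dE, are linearly independent.\<close>
definition kraus_lin_indep :: "nat \<Rightarrow> nat \<Rightarrow> nat \<Rightarrow> complex mat \<Rightarrow> bool" where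
  "kraus_lin_indep dY dE dIn T \<longleftrightarrow>
     (\<forall>c :: nat \<Rightarrow> complex.
        (\<forall>y<dY. \<forall>col<dIn. (\<Sum>k<dE. c k * T $$ (y * dE + k, col)) = 0) \<longrightarrow> (\<forall>k<dE. c k = 0))"

definition minimal_dilation :: "nat \<Rightarrow> (nat \<Rightarrow> nat) \<Rightarrow> nat \<Rightarrow> (nat \<Rightarrow> nat) \<Rightarrow> nat
     \<Rightarrow> (nat \<Rightarrow> nat \<Rightarrow> nat) \<Rightarrow> (nat \<Rightarrow> nat \<Rightarrow> complex mat) \<Rightarrow> bool" where
  "minimal_dilation m dX n dY dH dE \<tau> \<longleftrightarrow>
     (\<forall>i<m. \<forall>j<n. \<tau> i j \<in> carrier_mat (dY j * dE j i) (dX i * dH)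
        \<and> kraus_lin_indep (dY j) (dE j i) (dX i * dH) (\<tau> i j))"

definition trace_pres_dil :: "nat \<Rightarrow> (nat \<Rightarrow> nat) \<Rightarrow> nat \<Rightarrow> nat \<Rightarrow> (nat \<Rightarrow> nat \<Rightarrow> complex mat) \<Rightarrow> bool" where
  "trace_pres_dil m dX n dH \<tau> \<longleftrightarrow>
     (\<forall>i<m. msum (dX i * dH) (dX i * dH) (\<lambda>j. adj (\<tau> i j) * \<tau> i j) n = 1\<^sub>m (dX i * dH))"

text \<open>Partial transpose tau~ : X (x) E -> Y (x) H,
 tau~(x (x) e_k) = sum_h [(1 (x) <e_k|) tau (x (x) h)] (x) h.\<close>
definition ptransp :: "nat \<Rightarrow> nat \<Rightarrow> nat \<Rightarrow> nat \<Rightarrow> complex mat \<Rightarrow> complex mat" where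
  "ptransp dX dY dH dE T = mat (dY * dH) (dX * dE)
     (\<lambda>(r, c). T $$ ((r div dH) * dE + c mod dE, (c div dE) * dH + r mod dH))"

text \<open>M : (+)_{i<m} B(X_i (x) H1) -> (+)_{j<n} B(Y_j) with components M i j (input i, output j),
N : (+)_{j<n} B(Y_j (x) H2) -> (+)_{i<m} B(X_i) with components N j i, W a state on H1 (x) H2.\<close>
definition ent_left_inverse :: "nat \<Rightarrow> (nat \<Rightarrow> nat) \<Rightarrow> nat \<Rightarrow> (nat \<Rightarrow> nat) \<Rightarrow> nat \<Rightarrow> nat
     \<Rightarrow> (nat \<Rightarrow> nat \<Rightarrow> complex mat \<Rightarrow> complex mat) \<Rightarrow> complex mat
     \<Rightarrow> (nat \<Rightarrow> nat \<Rightarrow> complex mat \<Rightarrow> complex mat) \<Rightarrow> bool" where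
  "ent_left_inverse m dX n dY d1 d2 M W N \<longleftrightarrow>
     is_channel n (\<lambda>j. dY j * d2) m dX N \<and>
     (\<forall>\<rho>. (\<forall>i<m. \<rho> i \<in> carrier_mat (dX i) (dX i)) \<longrightarrow>
        (let MW = apply_map m (\<lambda>j. dY j * d2)
                    (\<lambda>i j. map_tensor_id (M i j) (dX i * d1) (dY j) d2) (\<lambda>i. kron (\<rho> i) W)
         in \<forall>i<m. apply_map n dX N MW i = \<rho> i))"

definition ent_inverse :: "nat \<Rightarrow> (nat \<Rightarrow> nat) \<Rightarrow> nat \<Rightarrow> (nat \<Rightarrow> nat) \<Rightarrow> nat \<Rightarrow> nat
     \<Rightarrow> (nat \<Rightarrow> nat \<Rightarrow> complex mat \<Rightarrow> complex mat) \<Rightarrow> complex mat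
     \<Rightarrow> (nat \<Rightarrow> nat \<Rightarrow> complex mat \<Rightarrow> complex mat) \<Rightarrow> bool" where
  "ent_inverse m dX n dY d1 d2 M W N \<longleftrightarrow>
     ent_left_inverse m dX n dY d1 d2 M W N \<and>
     (\<forall>\<sigma>. (\<forall>j<n. \<sigma> j \<in> carrier_mat (dY j) (dY j)) \<longrightarrow>
        (let NW = apply_map n (\<lambda>i. dX i * d1)
                    (\<lambda>j i. map_tensor_id (N j i) (dY j * d2) (dX i) d1)
                    (\<lambda>j. kron (\<sigma> j) (swap_state d1 d2 W))
         in \<forall>j<n. apply_map m dY M NW j = \<sigma> j))"

definition ent_invertible :: "nat \<Rightarrow> (nat \<Rightarrow> nat) \<Rightarrow> nat \<Rightarrow> (nat \<Rightarrow> nat) \<Rightarrow> nat \<Rightarrow> nat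
     \<Rightarrow> (nat \<Rightarrow> nat \<Rightarrow> complex mat \<Rightarrow> complex mat) \<Rightarrow> complex mat \<Rightarrow> bool" where
  "ent_invertible m dX n dY d1 d2 M W \<longleftrightarrow> (\<exists>N. ent_inverse m dX n dY d1 d2 M W N)"

end

theory Submission
  imports Defs
begin

text \<open>Write $K_k$ and $L_s$ for the Kraus operators of $M_{ij}$ and $N_{ji}$; for $N$ they exist by Choi's
theorem. The Kraus operators of $N (M \otimes \mathrm{id})(\cdot \otimes \Phi)$ are, up to a constant, the products
$L_s \tilde\tau_k$, and those of the other composition are $K_k \tilde L_s$. If the compositions are
identities then these products are scalars $\lambda_{sk}$ and $\mu_{ks}$, and comparing traces gives
$\mu_{ks} \dim Y_j = \lambda_{sk} \dim X_i$. Trace preservation makes $(K_k)$ and $(L_s)$ isometries, so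
one can solve $L_s = \sum_k \mu_{ks} \tilde\tau_k^\dagger$ and $\tilde\tau_k = \sum_s \lambda_{sk} L_s^\dagger$.
Inserting one in the other and using the linear independence of the $K_k$ yields
$\sum_s \overline{\mu_{k's}} \lambda_{sk} = \delta_{kk'}$, from which the orthogonality relations of $U_i$
and $W_j$ and the formula for $N$ follow. Conversely, the orthogonality relations make the two compositions
multiples of the identity, with factor 1 because $U_i$ and $W_j$ are square.\<close>

subsection \<open>Gram decomposition of positive semidefinite forms\<close>

text \<open>Nothing like minimality is known for \<open>N\<close>: Choi's theorem yields some family
  of Kraus operators, possibly linearly dependent. So \<open>lam\<close> and \<open>mu\<close> are
  rectangular, and only Gram relations summed over \<open>s\<close> are available; summing over
  \<open>k\<close> need not give a multiple of the identity. One side is enough: together with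
  \<open>mu_lam\<close> it says that sqrt(dim X_i / dim Y_j) times \<open>lam\<close> has
  orthonormal columns, which is the origin of the square root in W_j. It is also why
  \<open>N\<close> is unique: a completely positive map depends on its Kraus operators only through
  the sum over \<open>s\<close> of products of an entry with a conjugated entry, and there the
  relation eliminates \<open>mu\<close>. The maximally entangled state turns the H-input of a Kraus
  operator into an additional output. In coordinates this only regroups the indices y, k, x, h of
  one array, so the argument is carried out with finite sums of entries, and matrices return only
  where the statement mentions them.\<close>

lemma sum_prod_index:
  fixes f :: "nat \<Rightarrow> 'a::comm_monoid_add"
  shows "(\<Sum>r<a * b. f r) = (\<Sum>y<a. \<Sum>k<b. f (y * b + k))"
proof (induction a)
  case (Suc a)
  have split: "(\<Sum>r<c + b. f r) = (\<Sum>r<c. f r) + (\<Sum>k<b. f (c + k))" for c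
    by (induction b) (simp_all add: add.assoc)
  show ?case using Suc split[of "a * b"] by (simp add: add.commute)
qed simp

lemma prod_index_less: "y < a \<Longrightarrow> k < b \<Longrightarrow> y * b + k < a * (b::nat)"
proof -
  assume "y < a" "k < b"
  then have "y * b + k < Suc y * b" by simp
  also have "\<dots> \<le> a * b" using \<open>y < a\<close> by (intro mult_le_mono1) simp
  finally show ?thesis .
qed

definition qform :: "nat \<Rightarrow> (nat \<Rightarrow> nat \<Rightarrow> complex) \<Rightarrow> (nat \<Rightarrow> complex) \<Rightarrow> complex" where
  "qform d P v = (\<Sum>a<d. \<Sum>b<d. cnj (v a) * P a b * v b)"

definition qpos :: "nat \<Rightarrow> (nat \<Rightarrow> nat \<Rightarrow> complex) \<Rightarrow> bool" where
  "qpos d P \<longleftrightarrow> (\<forall>v. Im (qform d P v) = 0 \<and> Re (qform d P v) \<ge> 0)"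

lemma psd_qpos: "psd d P \<longleftrightarrow> P \<in> carrier_mat d d \<and> qpos d (\<lambda>a b. P $$ (a, b))"
  by (simp add: psd_def qpos_def qform_def Let_def)

lemma qform_single:
  assumes "a < d"
  shows "qform d P (\<lambda>c. if c = a then 1 else 0) = P a a"
proof -
  have "qform d P (\<lambda>c. if c = a then 1 else 0) = (\<Sum>c<d. \<Sum>e<d. if e = a then (if c = a then P a a else 0) else 0)"
    unfolding qform_def by (intro sum.cong refl) simp
  then show ?thesis using assms by simp
qed

lemma qform_pair:
  assumes "a < d" "b < d" "a \<noteq> b"
  shows "qform d P (\<lambda>c. if c = a then 1 else if c = b then z else 0)
    = P a a + P a b * z + cnj z * P b a + cnj z * P b b * z"
proof -
  let ?v = "\<lambda>c. if c = a then 1 else if c = b then z else 0"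
  have in1: "(\<Sum>e<d. P c e * ?v e) = P c a + P c b * z" for c
  proof -
    have "(\<Sum>e<d. P c e * ?v e) = (\<Sum>e<d. (if e = a then P c a else 0) + (if e = b then P c b * z else 0))"
      using assms by (intro sum.cong) auto
    then show ?thesis using assms by (simp add: sum.distrib)
  qed
  have "qform d P ?v = (\<Sum>c<d. cnj (?v c) * (\<Sum>e<d. P c e * ?v e))"
    unfolding qform_def by (simp add: sum_distrib_left mult.assoc)
  also have "\<dots> = (\<Sum>c<d. (if c = a then P a a + P a b * z else 0) + (if c = b then cnj z * (P b a + P b b * z) else 0))"
    unfolding in1 using assms by (intro sum.cong) auto
  also have "\<dots> = P a a + P a b * z + cnj z * (P b a + P b b * z)"
    using assms by (simp add: sum.distrib)
  finally show ?thesis by (simp add: algebra_simps)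
qed

text \<open>The form is real at e_a + e_b and at e_a + i e_b. The first fact compares the imaginary
  parts of \<open>P a b\<close> and \<open>P b a\<close>, the second their real parts.\<close>

lemma qpos_hermitian:
  assumes P: "qpos d P" and a: "a < d" and b: "b < d"
  shows "P b a = cnj (P a b)"
proof -
  have diag: "Im (P c c) = 0" if "c < d" for c
    using P qform_single[OF that, of P] unfolding qpos_def by metis
  show ?thesis
  proof (cases "a = b")
    case True
    then show ?thesis using diag[OF a] by (simp add: complex_eq_iff)
  next
    case False
    have q: "Im (P a a + P a b * z + cnj z * P b a + cnj z * P b b * z) = 0" for z
      using P qform_pair[OF a b False, of P z] unfolding qpos_def by metis
    show ?thesis
      using q[of 1] q[of \<i>] diag[OF a] diag[OF b] by (simp add: complex_eq_iff)
  qed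
qed

text \<open>With \<open>P b b = 0\<close> the form is affine along e_a - t
  \<open>cnj (P a b)\<close> e_b for real t, so a nonzero slope would make it negative
  somewhere.\<close>

lemma qpos_zero_diag:
  assumes P: "qpos d P" and a: "a < d" and b: "b < d" and z: "P b b = 0"
  shows "P a b = 0"
proof (rule ccontr)
  assume n: "P a b \<noteq> 0"
  with z have ab: "a \<noteq> b" by auto
  \<comment> \<open>Chosen so that the form takes the value -1.\<close>
  define t where "t = (Re (P a a) + 1) / (2 * (cmod (P a b))\<^sup>2)"
  have h: "P b a = cnj (P a b)" by (rule qpos_hermitian[OF P a b])
  have "0 \<le> Re (P a a + P a b * (- of_real t * cnj (P a b)) + cnj (- of_real t * cnj (P a b)) * P b a
      + cnj (- of_real t * cnj (P a b)) * P b b * (- of_real t * cnj (P a b)))"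
    using P qform_pair[OF a b ab, of P "- of_real t * cnj (P a b)"] unfolding qpos_def by metis
  also have "\<dots> = Re (P a a) - 2 * t * (cmod (P a b))\<^sup>2"
    unfolding cmod_power2 by (simp add: h z algebra_simps power2_eq_square)
  also have "\<dots> = -1" using n by (simp add: t_def field_simps)
  finally show False by simp
qed

lemma qform_Suc:
  "qform (Suc d) P v = qform d P v + cnj (v d) * (\<Sum>b<d. P d b * v b)
     + (\<Sum>a<d. cnj (v a) * P a d) * v d + cnj (v d) * P d d * v d"
  by (simp add: qform_def sum.distrib sum_distrib_left sum_distrib_right algebra_simps)

lemma qform_cong: "(\<And>a. a < d \<Longrightarrow> v a = w a) \<Longrightarrow> qform d P v = qform d P w"
  unfolding qform_def by (intro sum.cong) auto

text \<open>Cholesky decomposition: split off the rank one term of the last column.\<close>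
lemma qpos_gram:
  "qpos d P \<Longrightarrow> \<exists>S v. \<forall>a<d. \<forall>b<d. P a b = (\<Sum>s<(S::nat). v s a * cnj (v s b))"
proof (induction d arbitrary: P)
  case 0
  then show ?case by simp
next
  case (Suc d)
  note herm = qpos_hermitian[OF Suc.prems]
  have pd: "Im (P d d) = 0" "Re (P d d) \<ge> 0"
    using Suc.prems qform_single[of d "Suc d" P] unfolding qpos_def by (metis lessI)+
  define p where "p = Re (P d d)"
  have p: "P d d = of_real p" "p \<ge> 0" using pd by (auto simp: p_def complex_eq_iff)
  \<comment> \<open>If \<open>p = 0\<close>, division by zero gives \<open>w = 0\<close>. This is
    the right value, since the last column of \<open>P\<close> then vanishes by
    \<open>qpos_zero_diag\<close>.\<close>
  define w where "w a = P a d / of_real (sqrt p)" for a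
  define P' where "P' a b = P a b - w a * cnj (w b)" for a b
  have last: "P a d = w a * cnj (w d)" if "a < Suc d" for a
  proof (cases "p = 0")
    case True
    then show ?thesis using qpos_zero_diag[OF Suc.prems that, of d] p by (simp add: w_def)
  next
    case False
    with p have s: "of_real (sqrt p) * of_real (sqrt p) = (of_real p :: complex)" "sqrt p > 0"
      by (simp_all flip: of_real_mult)
    have "w a * cnj (w d) = P a d * of_real p / (of_real (sqrt p) * of_real (sqrt p))"
      by (simp add: w_def p(1))
    then show ?thesis using s False by simp
  qed
  have "qpos d P'"
    unfolding qpos_def
  proof
    fix u
    define y where "y = (\<Sum>b<d. P d b * u b)"
    \<comment> \<open>For \<open>p > 0\<close> the new last coordinate minimises the form of
      \<open>P\<close> with \<open>u\<close> fixed, and the minimum is the form of the Schur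
      complement \<open>P'\<close> at \<open>u\<close>. For \<open>p = 0\<close> the coordinate is 0
      and \<open>P'\<close> equals \<open>P\<close>.\<close>
    define v where "v = u(d := - y / of_real p)"
    have cy: "(\<Sum>a<d. cnj (u a) * P a d) = cnj y"
      unfolding y_def using herm[of d] by (simp add: mult.commute)
    have "qform (Suc d) P v = qform d P u + cnj (- y / of_real p) * y + cnj y * (- y / of_real p)
       + cnj (- y / of_real p) * P d d * (- y / of_real p)"
      unfolding qform_Suc using qform_cong[of d v u P] cy by (simp add: v_def y_def)
    also have "\<dots> = qform d P u - cnj y * y / of_real p"
      by (cases "p = 0") (simp_all add: p(1) field_simps)
    also have "\<dots> = qform d P' u"
    proof -
      have wy: "(\<Sum>a<d. cnj (u a) * w a) = cnj y / of_real (sqrt p)"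
        unfolding cy[symmetric] by (simp add: w_def sum_divide_distrib)
      have wy': "(\<Sum>b<d. cnj (w b) * u b) = y / of_real (sqrt p)"
        using arg_cong[OF wy, of cnj] by (simp add: mult.commute)
      have ss: "of_real (sqrt p) * of_real (sqrt p) = (of_real p :: complex)"
        using p(2) by (simp flip: of_real_mult)
      have "qform d P' u = qform d P u - (\<Sum>a<d. cnj (u a) * w a) * (\<Sum>b<d. cnj (w b) * u b)"
        unfolding qform_def P'_def sum_product
        by (simp add: sum_subtractf[symmetric] algebra_simps)
      then show ?thesis unfolding wy wy' using ss by simp
    qed
    finally show "Im (qform d P' u) = 0 \<and> 0 \<le> Re (qform d P' u)"
      using Suc.prems unfolding qpos_def by metis
  qed
  from Suc.IH[OF this] obtain S v where
    v: "\<And>a b. a < d \<Longrightarrow> b < d \<Longrightarrow> P' a b = (\<Sum>s<(S::nat). v s a * cnj (v s b))" by metis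
  define v' where "v' s a = (if s = S then w a else if a = d then 0 else v s a)" for s a
  have "P a b = (\<Sum>s<Suc S. v' s a * cnj (v' s b))" if ab: "a < Suc d" "b < Suc d" for a b
  proof -
    consider "a < d" "b < d" | "b = d" | "a = d" using ab unfolding less_Suc_eq by blast
    then show ?thesis
    proof cases
      case 1
      then show ?thesis using v[OF 1] by (simp add: v'_def P'_def algebra_simps)
    next
      case 2
      then show ?thesis using last[OF ab(1)] by (simp add: v'_def)
    next
      case 3
      then show ?thesis using last[OF ab(2)] herm[of b d] ab by (simp add: v'_def mult.commute)
    qed
  qed
  then show ?case by blast
qed

subsection \<open>Kraus representations\<close>

lemma sum_pull:
  fixes f g :: "_ \<Rightarrow> complex"
  shows "(\<Sum>r\<in>R. \<Sum>q\<in>R'. f r * (\<Sum>k\<in>C. Z k r q) * g q) = (\<Sum>k\<in>C. \<Sum>r\<in>R. \<Sum>q\<in>R'. f r * Z k r q * g q)"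
proof -
  have "(\<Sum>r\<in>R. \<Sum>q\<in>R'. f r * (\<Sum>k\<in>C. Z k r q) * g q) = (\<Sum>r\<in>R. \<Sum>q\<in>R'. \<Sum>k\<in>C. f r * Z k r q * g q)"
    by (simp add: sum_distrib_left sum_distrib_right)
  also have "\<dots> = (\<Sum>r\<in>R. \<Sum>k\<in>C. \<Sum>q\<in>R'. f r * Z k r q * g q)"
    by (intro sum.cong refl sum.swap)
  also have "\<dots> = (\<Sum>k\<in>C. \<Sum>r\<in>R. \<Sum>q\<in>R'. f r * Z k r q * g q)"
    by (rule sum.swap)
  finally show ?thesis .
qed

lemma sum_sandwich:
  fixes f g :: "_ \<Rightarrow> complex"
  shows "(\<Sum>r\<in>R. \<Sum>q\<in>R'. f r * (\<Sum>b\<in>B. \<Sum>c\<in>B'. T r b * Q b c * V q c) * g q)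
    = (\<Sum>b\<in>B. \<Sum>c\<in>B'. (\<Sum>r\<in>R. f r * T r b) * Q b c * (\<Sum>q\<in>R'. V q c * g q))"
  unfolding sum_pull
  by (intro sum.cong refl) (simp add: sum_distrib_left sum_distrib_right mult.assoc, rule sum.swap)

lemma sum_swap4:
  fixes f :: "_ \<Rightarrow> _ \<Rightarrow> _ \<Rightarrow> _ \<Rightarrow> complex"
  shows "(\<Sum>b\<in>B. \<Sum>g\<in>G. \<Sum>b'\<in>B'. \<Sum>g'\<in>G'. f b g b' g') = (\<Sum>g\<in>G. \<Sum>g'\<in>G'. \<Sum>b\<in>B. \<Sum>b'\<in>B'. f b g b' g')"
proof -
  have "(\<Sum>b\<in>B. \<Sum>g\<in>G. \<Sum>b'\<in>B'. \<Sum>g'\<in>G'. f b g b' g') = (\<Sum>g\<in>G. \<Sum>b\<in>B. \<Sum>b'\<in>B'. \<Sum>g'\<in>G'. f b g b' g')"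
    by (rule sum.swap)
  also have "\<dots> = (\<Sum>g\<in>G. \<Sum>b\<in>B. \<Sum>g'\<in>G'. \<Sum>b'\<in>B'. f b g b' g')"
    by (intro sum.cong refl sum.swap)
  also have "\<dots> = (\<Sum>g\<in>G. \<Sum>g'\<in>G'. \<Sum>b\<in>B. \<Sum>b'\<in>B'. f b g b' g')"
    by (intro sum.cong refl sum.swap)
  finally show ?thesis .
qed

text \<open>The map P -> sum_s K_s P K_s^dagger. The operators are entry functions rather than
  matrices, so that regrouping their indices costs nothing.\<close>

definition kraus_map :: "nat \<Rightarrow> nat \<Rightarrow> nat \<Rightarrow> (nat \<Rightarrow> nat \<Rightarrow> nat \<Rightarrow> complex) \<Rightarrow> complex mat \<Rightarrow> complex mat" where
  "kraus_map dB d S K P = mat dB dB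
     (\<lambda>(y, y'). \<Sum>s<S. \<Sum>r<d. \<Sum>q<d. K s y r * P $$ (r, q) * cnj (K s y' q))"

lemma kraus_map_carrier [simp]: "kraus_map dB d S K P \<in> carrier_mat dB dB"
  by (simp add: kraus_map_def)

lemma kraus_map_index [simp]: "y < dB \<Longrightarrow> y' < dB \<Longrightarrow>
  kraus_map dB d S K P $$ (y, y') = (\<Sum>s<S. \<Sum>r<d. \<Sum>q<d. K s y r * P $$ (r, q) * cnj (K s y' q))"
  by (simp add: kraus_map_def)

definition eunit :: "nat \<Rightarrow> nat \<Rightarrow> nat \<Rightarrow> complex mat" where
  "eunit d a b = mat d d (\<lambda>(r, q). if r = a \<and> q = b then 1 else 0)"

lemma eunit_carrier [simp]: "eunit d a b \<in> carrier_mat d d"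
  by (simp add: eunit_def)

lemma eunit_index [simp]: "r < d \<Longrightarrow> q < d \<Longrightarrow> eunit d a b $$ (r, q) = (if r = a \<and> q = b then 1 else 0)"
  by (simp add: eunit_def)

text \<open>Binary additivity is extended to the sum over all matrix units by induction on the set
  \<open>I\<close> of entries of \<open>P\<close> that are kept. The empty case, that
  \<open>f\<close> maps 0 to 0, comes from homogeneity with the scalar 0.\<close>

lemma lin_map_expand:
  assumes f: "lin_map d dB f" and P: "P \<in> carrier_mat d d" and y: "y < dB" "y' < dB"
  shows "f P $$ (y, y') = (\<Sum>r<d. \<Sum>q<d. P $$ (r, q) * f (eunit d r q) $$ (y, y'))"
proof -
  have car: "Q \<in> carrier_mat d d \<Longrightarrow> f Q \<in> carrier_mat dB dB" for Q
    using f by (simp add: lin_map_def)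
  have add: "A \<in> carrier_mat d d \<Longrightarrow> B \<in> carrier_mat d d \<Longrightarrow> f (A + B) = f A + f B" for A B
    using f by (simp add: lin_map_def)
  have sm: "A \<in> carrier_mat d d \<Longrightarrow> f (c \<cdot>\<^sub>m A) = c \<cdot>\<^sub>m f A" for A c
    using f by (simp add: lin_map_def)
  have part: "f (mat d d (\<lambda>p. if p \<in> I then P $$ p else 0)) $$ (y, y')
     = (\<Sum>(r, q)\<in>I. P $$ (r, q) * f (eunit d r q) $$ (y, y'))" if "finite I" for I
    using that
  proof (induction I rule: finite_induct)
    case empty
    have "f (mat d d (\<lambda>p. 0)) = f (0 \<cdot>\<^sub>m mat d d (\<lambda>p. 0))"
      by (intro arg_cong[of _ _ f] eq_matI) auto
    also have "\<dots> = 0 \<cdot>\<^sub>m f (mat d d (\<lambda>p. 0))" by (intro sm) simp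
    finally have "f (mat d d (\<lambda>p. 0)) $$ (y, y') = (0 \<cdot>\<^sub>m f (mat d d (\<lambda>p. 0))) $$ (y, y')" by simp
    also have "\<dots> = 0" using car[of "mat d d (\<lambda>p. 0)"] y by simp
    finally show ?case by simp
  next
    case (insert p I)
    obtain r q where p: "p = (r, q)" by (cases p)
    have "mat d d (\<lambda>x. if x \<in> insert p I then P $$ x else 0)
        = P $$ p \<cdot>\<^sub>m eunit d r q + mat d d (\<lambda>x. if x \<in> I then P $$ x else 0)"
      using insert.hyps by (intro eq_matI) (auto simp: p eunit_def)
    then have "f (mat d d (\<lambda>x. if x \<in> insert p I then P $$ x else 0))
        = P $$ p \<cdot>\<^sub>m f (eunit d r q) + f (mat d d (\<lambda>x. if x \<in> I then P $$ x else 0))"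
      by (simp add: add sm)
    then show ?case using insert car[of "eunit d r q"] car[of "mat d d (\<lambda>x. if x \<in> I then P $$ x else 0)"] y
      by (simp add: p)
  qed
  have "P = mat d d (\<lambda>p. if p \<in> {..<d} \<times> {..<d} then P $$ p else 0)"
    using P by (intro eq_matI) auto
  then have "f P $$ (y, y') = (\<Sum>(r, q)\<in>{..<d} \<times> {..<d}. P $$ (r, q) * f (eunit d r q) $$ (y, y'))"
    using part[of "{..<d} \<times> {..<d}"] by simp
  then show ?thesis by (simp add: sum.cartesian_product)
qed

text \<open>Choi's theorem: the Gram vectors of the Choi matrix are the Kraus operators.\<close>
lemma compl_pos_kraus:
  assumes f: "lin_map d dB f" and cp: "compl_pos d dB f"
  shows "\<exists>S K. \<forall>P\<in>carrier_mat d d. f P = kraus_map dB d S K P"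
proof -
  let ?v = "\<lambda>r::nat. if r div d = r mod d then 1 else (0::complex)"
  \<comment> \<open>The unnormalised maximally entangled projector. It is positive of rank at most
    one and its blocks are the matrix units, so applying \<open>f\<close> blockwise gives the Choi
    matrix.\<close>
  define Q where "Q = mat (d * d) (d * d) (\<lambda>(r, c). ?v r * ?v c)"
  have "psd (d * d) Q"
    unfolding psd_qpos qpos_def
  proof (intro conjI allI)
    fix u
    define z where "z = (\<Sum>b<d * d. ?v b * u b)"
    have "qform (d * d) (\<lambda>a b. Q $$ (a, b)) u = (\<Sum>a<d * d. \<Sum>b<d * d. cnj (u a) * (?v a * ?v b) * u b)"
      unfolding qform_def Q_def by (intro sum.cong refl) simp
    also have "\<dots> = (\<Sum>a<d * d. cnj (?v a * u a)) * z"
      unfolding z_def sum_product by (intro sum.cong refl) simp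
    also have "\<dots> = cnj z * z" by (simp add: z_def)
    finally have q: "qform (d * d) (\<lambda>a b. Q $$ (a, b)) u = cnj z * z" .
    show "Im (qform (d * d) (\<lambda>a b. Q $$ (a, b)) u) = 0" "0 \<le> Re (qform (d * d) (\<lambda>a b. Q $$ (a, b)) u)"
      unfolding q by simp_all
  qed (simp add: Q_def)
  then have "psd (dB * d) (map_tensor_id f d dB d Q)" using cp by (simp add: compl_pos_def)
  then have "qpos (dB * d) (\<lambda>a b. map_tensor_id f d dB d Q $$ (a, b))" by (simp add: psd_qpos)
  from qpos_gram[OF this] obtain S :: nat and v where v: "\<forall>a<dB * d. \<forall>b<dB * d.
      map_tensor_id f d dB d Q $$ (a, b) = (\<Sum>s<S. v s a * cnj (v s b))"
    by blast
  have E: "f (eunit d r q) $$ (y, y') = (\<Sum>s<S. v s (y * d + r) * cnj (v s (y' * d + q)))"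
    if "r < d" "q < d" "y < dB" "y' < dB" for r q y y'
  proof -
    have "blk d d Q r q = eunit d r q"
      using that by (intro eq_matI) (auto simp: blk_def Q_def eunit_def prod_index_less)
    then have "map_tensor_id f d dB d Q $$ (y * d + r, y' * d + q) = f (eunit d r q) $$ (y, y')"
      using that by (simp add: map_tensor_id_def prod_index_less)
    then show ?thesis using v[rule_format, of "y * d + r" "y' * d + q"] that by (simp add: prod_index_less)
  qed
  \<comment> \<open>Each Gram vector of length \<open>dB * d\<close>, read as a \<open>dB\<close> by
    \<open>d\<close> array, is a Kraus operator.\<close>
  have "f P = kraus_map dB d S (\<lambda>s y r. v s (y * d + r)) P" if P: "P \<in> carrier_mat d d" for P
  proof (rule eq_matI)
    fix y y' assume "y < dim_row (kraus_map dB d S (\<lambda>s y r. v s (y * d + r)) P)"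
      "y' < dim_col (kraus_map dB d S (\<lambda>s y r. v s (y * d + r)) P)"
    then have y: "y < dB" "y' < dB" by (simp_all add: kraus_map_def)
    have "f P $$ (y, y') = (\<Sum>r<d. \<Sum>q<d. \<Sum>s<S. v s (y * d + r) * P $$ (r, q) * cnj (v s (y' * d + q)))"
      unfolding lin_map_expand[OF f P y] using y
      by (intro sum.cong refl) (simp add: E sum_distrib_left mult_ac)
    also have "\<dots> = (\<Sum>s<S. \<Sum>r<d. \<Sum>q<d. v s (y * d + r) * P $$ (r, q) * cnj (v s (y' * d + q)))"
      by (rule trans[OF sum.cong[OF refl sum.swap] sum.swap])
    finally show "f P $$ (y, y') = kraus_map dB d S (\<lambda>s y r. v s (y * d + r)) P $$ (y, y')"
      using y by simp
  qed (use f P in \<open>auto simp: lin_map_def kraus_map_def\<close>)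
  then show ?thesis by blast
qed

lemma lin_map_kraus_map: "lin_map d dB (kraus_map dB d S K)"
  unfolding lin_map_def
proof (intro conjI ballI allI)
  fix P Q :: "complex mat" assume PQ: "P \<in> carrier_mat d d" "Q \<in> carrier_mat d d"
  show "kraus_map dB d S K (P + Q) = kraus_map dB d S K P + kraus_map dB d S K Q"
  proof (rule eq_matI)
    fix y y' assume "y < dim_row (kraus_map dB d S K P + kraus_map dB d S K Q)"
      "y' < dim_col (kraus_map dB d S K P + kraus_map dB d S K Q)"
    then have y: "y < dB" "y' < dB" by (simp_all add: kraus_map_def)
    have "kraus_map dB d S K (P + Q) $$ (y, y')
      = (\<Sum>s<S. \<Sum>r<d. \<Sum>q<d. K s y r * P $$ (r, q) * cnj (K s y' q) + K s y r * Q $$ (r, q) * cnj (K s y' q))"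
      using y PQ by (auto intro!: sum.cong simp: distrib_left distrib_right)
    then show "kraus_map dB d S K (P + Q) $$ (y, y') = (kraus_map dB d S K P + kraus_map dB d S K Q) $$ (y, y')"
      using y by (simp add: sum.distrib kraus_map_def)
  qed (simp_all add: kraus_map_def)
next
  fix P :: "complex mat" and c assume P: "P \<in> carrier_mat d d"
  show "kraus_map dB d S K (c \<cdot>\<^sub>m P) = c \<cdot>\<^sub>m kraus_map dB d S K P"
  proof (rule eq_matI)
    fix y y' assume "y < dim_row (c \<cdot>\<^sub>m kraus_map dB d S K P)" "y' < dim_col (c \<cdot>\<^sub>m kraus_map dB d S K P)"
    then have y: "y < dB" "y' < dB" by (simp_all add: kraus_map_def)
    have "kraus_map dB d S K (c \<cdot>\<^sub>m P) $$ (y, y')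
      = (\<Sum>s<S. \<Sum>r<d. \<Sum>q<d. c * (K s y r * P $$ (r, q) * cnj (K s y' q)))"
      using y P by (auto intro!: sum.cong)
    then show "kraus_map dB d S K (c \<cdot>\<^sub>m P) $$ (y, y') = (c \<cdot>\<^sub>m kraus_map dB d S K P) $$ (y, y')"
      using y by (simp add: sum_distrib_left kraus_map_def)
  qed (simp_all add: kraus_map_def)
qed simp

text \<open>The form of the image at \<open>v\<close> is the sum over \<open>s\<close> of the forms
  of \<open>P\<close> at (K_s^dagger tensor 1) \<open>v\<close>, each of which is
  nonnegative.\<close>

lemma compl_pos_kraus_map: "compl_pos d dB (kraus_map dB d S K)"
  unfolding compl_pos_def
proof (intro allI impI)
  fix k P assume P: "psd (d * k) P"
  define G where "G = map_tensor_id (kraus_map dB d S K) d dB k P"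
  have G: "G $$ (b * k + g, b' * k + g')
      = (\<Sum>s<S. \<Sum>p<d. \<Sum>p'<d. K s b p * P $$ (p * k + g, p' * k + g') * cnj (K s b' p'))"
    if "b < dB" "g < k" "b' < dB" "g' < k" for b g b' g'
    using that by (simp add: G_def map_tensor_id_def prod_index_less blk_def)
  have "qform (dB * k) (\<lambda>a b. G $$ (a, b)) v
      = (\<Sum>s<S. qform (d * k) (\<lambda>a b. P $$ (a, b)) (\<lambda>q. \<Sum>b<dB. cnj (K s b (q div k)) * v (b * k + q mod k)))" for v
  proof -
    have "qform (dB * k) (\<lambda>a b. G $$ (a, b)) v = (\<Sum>b<dB. \<Sum>g<k. \<Sum>b'<dB. \<Sum>g'<k.
        cnj (v (b * k + g)) * G $$ (b * k + g, b' * k + g') * v (b' * k + g'))"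
      unfolding qform_def sum_prod_index ..
    also have "\<dots> = (\<Sum>g<k. \<Sum>g'<k. \<Sum>b<dB. \<Sum>b'<dB.
        cnj (v (b * k + g)) * G $$ (b * k + g, b' * k + g') * v (b' * k + g'))"
      by (rule sum_swap4)
    also have "\<dots> = (\<Sum>g<k. \<Sum>g'<k. \<Sum>b<dB. \<Sum>b'<dB.
        cnj (v (b * k + g)) * (\<Sum>s<S. \<Sum>p<d. \<Sum>p'<d. K s b p * P $$ (p * k + g, p' * k + g') * cnj (K s b' p')) * v (b' * k + g'))"
      by (intro sum.cong refl) (simp add: G)
    also have "\<dots> = (\<Sum>g<k. \<Sum>g'<k. \<Sum>s<S. \<Sum>p<d. \<Sum>p'<d. (\<Sum>b<dB. cnj (v (b * k + g)) * K s b p)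
        * P $$ (p * k + g, p' * k + g') * (\<Sum>b<dB. cnj (K s b p') * v (b * k + g')))"
      by (rule sum.cong[OF refl sum.cong[OF refl trans[OF sum_pull sum.cong[OF refl sum_sandwich]]]])
    also have "\<dots> = (\<Sum>s<S. \<Sum>g<k. \<Sum>g'<k. \<Sum>p<d. \<Sum>p'<d. (\<Sum>b<dB. cnj (v (b * k + g)) * K s b p)
        * P $$ (p * k + g, p' * k + g') * (\<Sum>b<dB. cnj (K s b p') * v (b * k + g')))"
      by (rule trans[OF sum.cong[OF refl sum.swap] sum.swap])
    also have "\<dots> = (\<Sum>s<S. \<Sum>p<d. \<Sum>g<k. \<Sum>p'<d. \<Sum>g'<k. (\<Sum>b<dB. cnj (v (b * k + g)) * K s b p)
        * P $$ (p * k + g, p' * k + g') * (\<Sum>b<dB. cnj (K s b p') * v (b * k + g')))"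
      by (rule sum.cong[OF refl sum_swap4[symmetric]])
    also have "\<dots> = (\<Sum>s<S. qform (d * k) (\<lambda>a b. P $$ (a, b)) (\<lambda>q. \<Sum>b<dB. cnj (K s b (q div k)) * v (b * k + q mod k)))"
      unfolding qform_def sum_prod_index[of _ d k] by (intro sum.cong refl arg_cong2[of _ _ _ _ times]) (simp_all add: mult.commute)
    finally show ?thesis .
  qed
  moreover have "Im (qform (d * k) (\<lambda>a b. P $$ (a, b)) u) = 0" "0 \<le> Re (qform (d * k) (\<lambda>a b. P $$ (a, b)) u)" for u
    using P unfolding psd_qpos qpos_def by blast+
  ultimately have "qpos (dB * k) (\<lambda>a b. G $$ (a, b))"
    unfolding qpos_def by (simp add: sum_nonneg)
  then show "psd (dB * k) (map_tensor_id (kraus_map dB d S K) d dB k P)"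
    unfolding psd_qpos G_def by (simp add: map_tensor_id_def)
qed

subsection \<open>Composition through a maximally entangled state\<close>

lemma sum_norm_eq_0D:
  fixes z :: "'q \<Rightarrow> complex"
  assumes "finite Q" "(\<Sum>q\<in>Q. z q * cnj (z q)) = 0" "q \<in> Q"
  shows "z q = 0"
proof -
  have "of_real (\<Sum>q\<in>Q. (cmod (z q))\<^sup>2) = (\<Sum>q\<in>Q. z q * cnj (z q))"
    by (simp only: of_real_sum complex_norm_square)
  then have "(\<Sum>q\<in>Q. (cmod (z q))\<^sup>2) = 0" using assms(2) by (metis of_real_eq_0_iff)
  then have "(cmod (z q))\<^sup>2 = 0" using assms by (simp add: sum_nonneg_eq_0_iff)
  then show ?thesis by simp
qed

text \<open>For fixed (a, b) the entries \<open>A q a b\<close> form a vector indexed by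
  \<open>q\<close>, and the hypothesis lists all inner products of these vectors. Off-diagonal ones
  have norm 0; diagonal ones have all mutual inner products equal to \<open>c\<close>, so their
  differences have norm c - c - c + c = 0. The flag \<open>e\<close> stands for equality of the two
  block indices and lets one lemma cover both cases.\<close>

lemma kraus_identity_scalar:
  fixes A :: "'q \<Rightarrow> nat \<Rightarrow> nat \<Rightarrow> complex"
  assumes fin: "finite Q" and d: "0 < d" "e \<Longrightarrow> d = d'"
    and A: "\<And>a a' b b'. a < d \<Longrightarrow> a' < d \<Longrightarrow> b < d' \<Longrightarrow> b' < d' \<Longrightarrow>
      (\<Sum>q\<in>Q. A q a b * cnj (A q a' b')) = (if e \<and> a = b \<and> a' = b' then c else 0)"
    and q: "q \<in> Q" "a < d" "b < d'"
  shows "A q a b = (if e \<and> a = b then A q 0 0 else 0)"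
proof (cases "e \<and> a = b")
  case True
  then have d': "d = d'" using d by simp
  have "(\<Sum>q\<in>Q. (A q a a - A q 0 0) * cnj (A q a a - A q 0 0)) = 
     (\<Sum>q\<in>Q. A q a a * cnj (A q a a)) - (\<Sum>q\<in>Q. A q a a * cnj (A q 0 0))
     - (\<Sum>q\<in>Q. A q 0 0 * cnj (A q a a)) + (\<Sum>q\<in>Q. A q 0 0 * cnj (A q 0 0))"
    by (simp add: algebra_simps sum.distrib sum_subtractf)
  also have "\<dots> = 0" using A q d' d True by simp
  finally have "A q a a - A q 0 0 = 0" by (rule sum_norm_eq_0D[OF fin _ q(1)])
  then show ?thesis using True by simp
next
  case False
  then have "(\<Sum>q\<in>Q. A q a b * cnj (A q a b)) = 0" using A[of a a b b] q by auto
  then have "A q a b = 0" by (rule sum_norm_eq_0D[OF fin _ q(1)])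
  then show ?thesis using False by auto
qed

section \<open>The maximally entangled state in coordinates\<close>

lemma max_ent_index: "g < d \<Longrightarrow> h < d \<Longrightarrow> g' < d \<Longrightarrow> h' < d \<Longrightarrow>
  max_ent d $$ (g * d + h, g' * d + h') = (if g = h \<and> g' = h' then 1 / of_nat d else 0)"
  by (simp add: max_ent_def prod_index_less)

text \<open>This symmetry gives the two conditions of \<open>ent_inverse\<close> the same shape,
  with the roles of the channels exchanged.\<close>

lemma swap_max_ent: "swap_state d d (max_ent d) = max_ent d"
proof (rule eq_matI)
  fix r c assume "r < dim_row (max_ent d)" "c < dim_col (max_ent d)"
  then have rc: "r < d * d" "c < d * d" by (simp_all add: max_ent_def)
  then have "0 < d" by (cases d) auto
  then have m: "r mod d < d" "c mod d < d" by simp_all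
  have "r div d < d" "c div d < d" using rc by (simp_all add: less_mult_imp_div_less)
  then show "swap_state d d (max_ent d) $$ (r, c) = max_ent d $$ (r, c)"
    using rc m by (auto simp: swap_state_def max_ent_index) (auto simp: max_ent_def)
qed (simp_all add: swap_state_def max_ent_def)

lemma kron_max_ent_blk:
  assumes "\<rho> \<in> carrier_mat dX dX" "h < d" "h' < d" "b < dX" "g < d" "b' < dX" "g' < d"
  shows "blk (dX * d) d (kron \<rho> (max_ent d)) h h' $$ (b * d + g, b' * d + g')
    = (if g = h \<and> g' = h' then \<rho> $$ (b, b') / of_nat d else 0)"
proof -
  \<comment> \<open>Associativity of the tensor product: (X H) H on the left, as \<open>blk\<close>
    reads it, and X (H H) on the right, as \<open>kron\<close> builds it.\<close>
  have idx: "(b * d + g) * d + h = b * (d * d) + (g * d + h)" for b g h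
    by (simp add: algebra_simps)
  have lt: "g * d + h < d * d" "g' * d + h' < d * d"
    using assms by (auto intro: prod_index_less)
  have "kron \<rho> (max_ent d) $$ (b * (d * d) + (g * d + h), b' * (d * d) + (g' * d + h'))
    = \<rho> $$ (b, b') * max_ent d $$ (g * d + h, g' * d + h')"
    using assms lt prod_index_less[of b dX "g * d + h" "d * d"] prod_index_less[of b' dX "g' * d + h'" "d * d"]
    unfolding kron_def by (simp add: max_ent_def)
  then show ?thesis
    using assms by (simp add: blk_def prod_index_less idx max_ent_index)
qed

text \<open>The state forces the H-input of a Kraus operator to equal the index of the untouched
  second factor. What remains is conjugation of \<open>\<rho>\<close> by the partially transposed
  Kraus operators, whose output carries both Y and H, divided by \<open>d\<close>.\<close>

lemma map_tensor_id_max_ent: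
  assumes M: "\<And>P. P \<in> carrier_mat (dX * d) (dX * d) \<Longrightarrow> M P = kraus_map dY (dX * d) S K P"
    and \<rho>: "\<rho> \<in> carrier_mat dX dX" and r: "r < dY * d" "q < dY * d"
  shows "map_tensor_id M (dX * d) dY d (kron \<rho> (max_ent d)) $$ (r, q)
    = (\<Sum>k<S. \<Sum>b<dX. \<Sum>b'<dX. K k (r div d) (b * d + r mod d) * (\<rho> $$ (b, b') / of_nat d)
         * cnj (K k (q div d) (b' * d + q mod d)))"
proof -
  have "0 < d" using r by (cases d) auto
  then have m: "r mod d < d" "q mod d < d" by simp_all
  have v: "r div d < dY" "q div d < dY" using r by (simp_all add: less_mult_imp_div_less)
  let ?B = "blk (dX * d) d (kron \<rho> (max_ent d)) (r mod d) (q mod d)"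
  have "map_tensor_id M (dX * d) dY d (kron \<rho> (max_ent d)) $$ (r, q) = M ?B $$ (r div d, q div d)"
    using r by (simp add: map_tensor_id_def)
  also have "M ?B = kraus_map dY (dX * d) S K ?B"
    by (rule M) (simp add: blk_def)
  also have "\<dots> $$ (r div d, q div d) = (\<Sum>k<S. \<Sum>b<dX. \<Sum>g<d. \<Sum>b'<dX. \<Sum>g'<d.
      K k (r div d) (b * d + g) * ?B $$ (b * d + g, b' * d + g') * cnj (K k (q div d) (b' * d + g')))"
    using v by (simp add: sum_prod_index)
  also have "\<dots> = (\<Sum>k<S. \<Sum>b<dX. \<Sum>g<d. \<Sum>b'<dX. \<Sum>g'<d. if g' = q mod d then (if g = r mod d then
      K k (r div d) (b * d + g) * (\<rho> $$ (b, b') / of_nat d) * cnj (K k (q div d) (b' * d + g')) else 0) else 0)"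
    using \<rho> m by (intro sum.cong refl) (simp add: kron_max_ent_blk)
  also have "\<dots> = (\<Sum>k<S. \<Sum>b<dX. \<Sum>g<d. if g = r mod d then \<Sum>b'<dX.
      K k (r div d) (b * d + g) * (\<rho> $$ (b, b') / of_nat d) * cnj (K k (q div d) (b' * d + q mod d)) else 0)"
    using m by (intro sum.cong refl) simp
  also have "\<dots> = (\<Sum>k<S. \<Sum>b<dX. \<Sum>b'<dX. K k (r div d) (b * d + r mod d) * (\<rho> $$ (b, b') / of_nat d)
         * cnj (K k (q div d) (b' * d + q mod d)))"
    using m by simp
  finally show ?thesis .
qed

text \<open>Up to the factor $1/\sqrt d$, the Kraus operators of $N (M \otimes \mathrm{id})(\cdot \otimes \Phi)$
for Kraus operators \<open>K\<close> of \<open>M\<close> and \<open>L\<close> of \<open>N\<close>.\<close>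
definition kcomp :: "nat \<Rightarrow> nat \<Rightarrow> (nat \<Rightarrow> nat \<Rightarrow> nat \<Rightarrow> complex) \<Rightarrow> (nat \<Rightarrow> nat \<Rightarrow> nat \<Rightarrow> complex)
    \<Rightarrow> nat \<Rightarrow> nat \<Rightarrow> nat \<Rightarrow> nat \<Rightarrow> complex" where
  "kcomp dY d L K s k a b = (\<Sum>y<dY. \<Sum>h<d. L s a (y * d + h) * K k y (b * d + h))"

text \<open>The left side of the identity in \<open>ent_left_inverse\<close>, kept symmetric in
  form: by \<open>swap_max_ent\<close> the opposite composition is
  \<open>ent_comp n dY m dX d N M\<close>.\<close>

abbreviation ent_comp :: "nat \<Rightarrow> (nat \<Rightarrow> nat) \<Rightarrow> nat \<Rightarrow> (nat \<Rightarrow> nat) \<Rightarrow> nat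
    \<Rightarrow> (nat \<Rightarrow> nat \<Rightarrow> complex mat \<Rightarrow> complex mat) \<Rightarrow> (nat \<Rightarrow> nat \<Rightarrow> complex mat \<Rightarrow> complex mat)
    \<Rightarrow> (nat \<Rightarrow> complex mat) \<Rightarrow> nat \<Rightarrow> complex mat" where
  "ent_comp m dX n dY d M N \<rho> \<equiv> apply_map n dX N (apply_map m (\<lambda>j. dY j * d)
     (\<lambda>i j. map_tensor_id (M i j) (dX i * d) (dY j) d) (\<lambda>i. kron (\<rho> i) (max_ent d)))"

definition kraus_family :: "nat \<Rightarrow> (nat \<Rightarrow> nat) \<Rightarrow> nat \<Rightarrow> (nat \<Rightarrow> nat) \<Rightarrow> (nat \<Rightarrow> nat \<Rightarrow> complex mat \<Rightarrow> complex mat)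
    \<Rightarrow> (nat \<Rightarrow> nat \<Rightarrow> nat) \<Rightarrow> (nat \<Rightarrow> nat \<Rightarrow> nat \<Rightarrow> nat \<Rightarrow> nat \<Rightarrow> complex) \<Rightarrow> bool" where
  "kraus_family m dIn n dOut M S K \<longleftrightarrow> (\<forall>i<m. \<forall>j<n. \<forall>P\<in>carrier_mat (dIn i) (dIn i).
     M i j P = kraus_map (dOut j) (dIn i) (S i j) (K i j) P)"

text \<open>From block i' to block i the composition has one Kraus operator for each triple (j, s,
  k), namely \<open>kcomp\<close> divided by the square root of \<open>d\<close>. Inside the proof,
  \<open>T\<close> is the partial transpose of \<open>K\<close>.\<close>

lemma ent_comp_index:
  assumes M: "kraus_family m (\<lambda>i. dX i * d) n dY M SM K"
    and N: "kraus_family n (\<lambda>j. dY j * d) m dX N SN L"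
    and \<rho>: "\<And>i. i < m \<Longrightarrow> \<rho> i \<in> carrier_mat (dX i) (dX i)"
    and i: "i < m" and a: "a < dX i" "a' < dX i"
  shows "ent_comp m dX n dY d M N \<rho> i $$ (a, a')
    = (\<Sum>j<n. \<Sum>s<SN j i. \<Sum>i'<m. \<Sum>k<SM i' j. \<Sum>b<dX i'. \<Sum>b'<dX i'.
        kcomp (dY j) d (L j i) (K i' j) s k a b * (\<rho> i' $$ (b, b') / of_nat d)
        * cnj (kcomp (dY j) d (L j i) (K i' j) s k a' b'))"
proof -
  define MW where "MW = apply_map m (\<lambda>j. dY j * d)
     (\<lambda>i j. map_tensor_id (M i j) (dX i * d) (dY j) d) (\<lambda>i. kron (\<rho> i) (max_ent d))"
  define T where "T i j k r b = K i j k (r div d) (b * d + r mod d)" for i j k r b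
  have car: "MW j \<in> carrier_mat (dY j * d) (dY j * d)" for j
    by (simp add: MW_def apply_map_def msum_def)
  have MW: "MW j $$ (r, q) = (\<Sum>i'<m. \<Sum>k<SM i' j. \<Sum>b<dX i'. \<Sum>b'<dX i'.
      T i' j k r b * (\<rho> i' $$ (b, b') / of_nat d) * cnj (T i' j k q b'))"
    if "j < n" "r < dY j * d" "q < dY j * d" for j r q
  proof -
    have "map_tensor_id (M i' j) (dX i' * d) (dY j) d (kron (\<rho> i') (max_ent d)) $$ (r, q)
      = (\<Sum>k<SM i' j. \<Sum>b<dX i'. \<Sum>b'<dX i'. T i' j k r b * (\<rho> i' $$ (b, b') / of_nat d) * cnj (T i' j k q b'))"
      if "i' < m" for i'
      unfolding T_def using M \<open>i' < m\<close> \<open>j < n\<close> \<open>r < _\<close> \<open>q < _\<close>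
      by (intro map_tensor_id_max_ent \<rho>) (auto simp: kraus_family_def)
    then show ?thesis using that by (simp add: MW_def apply_map_def msum_def)
  qed
  have kc: "(\<Sum>r<dY j * d. L j i s a r * T i' j k r b) = kcomp (dY j) d (L j i) (K i' j) s k a b" for j s i' k a b
    unfolding kcomp_def sum_prod_index T_def by (intro sum.cong refl) simp
  have kc': "(\<Sum>r<dY j * d. cnj (T i' j k r b) * cnj (L j i s a r)) = cnj (kcomp (dY j) d (L j i) (K i' j) s k a b)" for j s i' k a b
    unfolding kc[symmetric] by (simp add: mult.commute)
  have "apply_map n dX N MW i $$ (a, a') = (\<Sum>j<n. \<Sum>s<SN j i. \<Sum>r<dY j * d. \<Sum>q<dY j * d.
      L j i s a r * MW j $$ (r, q) * cnj (L j i s a' q))"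
    using N car a i by (simp add: apply_map_def msum_def kraus_family_def)
  also have "\<dots> = (\<Sum>j<n. \<Sum>s<SN j i. \<Sum>r<dY j * d. \<Sum>q<dY j * d.
      L j i s a r * (\<Sum>i'<m. \<Sum>k<SM i' j. \<Sum>b<dX i'. \<Sum>b'<dX i'.
      T i' j k r b * (\<rho> i' $$ (b, b') / of_nat d) * cnj (T i' j k q b')) * cnj (L j i s a' q))"
    by (intro sum.cong refl) (simp add: MW)
  also have "\<dots> = (\<Sum>j<n. \<Sum>s<SN j i. \<Sum>i'<m. \<Sum>r<dY j * d. \<Sum>q<dY j * d.
      L j i s a r * (\<Sum>k<SM i' j. \<Sum>b<dX i'. \<Sum>b'<dX i'.
      T i' j k r b * (\<rho> i' $$ (b, b') / of_nat d) * cnj (T i' j k q b')) * cnj (L j i s a' q))"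
    by (rule sum.cong[OF refl sum.cong[OF refl sum_pull]])
  also have "\<dots> = (\<Sum>j<n. \<Sum>s<SN j i. \<Sum>i'<m. \<Sum>k<SM i' j. \<Sum>b<dX i'. \<Sum>b'<dX i'.
       (\<Sum>r<dY j * d. L j i s a r * T i' j k r b) * (\<rho> i' $$ (b, b') / of_nat d)
        * (\<Sum>q<dY j * d. cnj (T i' j k q b') * cnj (L j i s a' q)))"
    by (rule sum.cong[OF refl sum.cong[OF refl sum.cong[OF refl trans[OF sum_pull sum.cong[OF refl sum_sandwich]]]]])
  finally show ?thesis unfolding kc kc' MW_def .
qed

text \<open>Feeding a matrix unit in the single block i' into the identity gives exactly the inner
  products required by \<open>kraus_identity_scalar\<close>, also when i and i' differ.\<close>

lemma ent_comp_scalar: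
  assumes M: "kraus_family m (\<lambda>i. dX i * d) n dY M SM K"
    and N: "kraus_family n (\<lambda>j. dY j * d) m dX N SN L"
    and d: "0 < d"
    and id: "\<And>\<rho>. (\<And>i. i < m \<Longrightarrow> \<rho> i \<in> carrier_mat (dX i) (dX i)) \<Longrightarrow> ent_comp m dX n dY d M N \<rho> i = \<rho> i"
    and i: "i < m" "i' < m" "j < n" "s < SN j i" "k < SM i' j" "a < dX i" "b < dX i'"
  shows "kcomp (dY j) d (L j i) (K i' j) s k a b
    = (if i = i' \<and> a = b then kcomp (dY j) d (L j i) (K i' j) s k 0 0 else 0)"
proof -
  let ?Q = "SIGMA j:{..<n}. {..<SN j i} \<times> {..<SM i' j}"
  let ?A = "\<lambda>(j, s, k) a b. kcomp (dY j) d (L j i) (K i' j) s k a b"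
  have "?A (j, s, k) a b = (if i = i' \<and> a = b then ?A (j, s, k) 0 0 else 0)"
  proof (rule kraus_identity_scalar[where Q = ?Q and d = "dX i" and d' = "dX i'" and c = "of_nat d"])
    fix a a' b b' assume a: "a < dX i" "a' < dX i" and b: "b < dX i'" "b' < dX i'"
    \<comment> \<open>A probe in block i' only. The constant \<open>c = of_nat d\<close> above
      undoes the normalisation of \<open>max_ent\<close>.\<close>
    define \<rho> where "\<rho> c = (if c = i' then eunit (dX i') b b' else 0\<^sub>m (dX c) (dX c))" for c
    have \<rho>: "\<rho> c \<in> carrier_mat (dX c) (dX c)" for c by (simp add: \<rho>_def)
    have E: "(\<Sum>p<dX c. \<Sum>p'<dX c. F p * (\<rho> c $$ (p, p') / of_nat d) * cnj (G p'))
       = (if c = i' then F b * cnj (G b') / of_nat d else 0)" for c and F G :: "nat \<Rightarrow> complex"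
    proof (cases "c = i'")
      case True
      have "(\<Sum>p<dX i'. \<Sum>p'<dX i'. F p * (eunit (dX i') b b' $$ (p, p') / of_nat d) * cnj (G p'))
        = (\<Sum>p<dX i'. \<Sum>p'<dX i'. if p' = b' then (if p = b then F b * cnj (G b') / of_nat d else 0) else 0)"
        by (intro sum.cong refl) auto
      then show ?thesis using True b by (simp add: \<rho>_def)
    qed (simp add: \<rho>_def)
    have "(if i = i' \<and> a = b \<and> a' = b' then 1 else 0) = \<rho> i $$ (a, a')"
      using a b i by (auto simp: \<rho>_def)
    also have "\<dots> = (\<Sum>j<n. \<Sum>s<SN j i. \<Sum>c<m. \<Sum>k<SM c j. if c = i' then
        kcomp (dY j) d (L j i) (K c j) s k a b * cnj (kcomp (dY j) d (L j i) (K c j) s k a' b') / of_nat d else 0)"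
      unfolding id[of \<rho>, OF \<rho>, symmetric] ent_comp_index[OF M N \<rho> i(1) a] E ..
    also have "\<dots> = (\<Sum>j<n. \<Sum>s<SN j i. \<Sum>c<m. if c = i' then \<Sum>k<SM c j. 
        kcomp (dY j) d (L j i) (K c j) s k a b * cnj (kcomp (dY j) d (L j i) (K c j) s k a' b') / of_nat d else 0)"
      by (intro sum.cong refl) simp
    also have "\<dots> = (\<Sum>j<n. \<Sum>s<SN j i. \<Sum>k<SM i' j. 
        kcomp (dY j) d (L j i) (K i' j) s k a b * cnj (kcomp (dY j) d (L j i) (K i' j) s k a' b') / of_nat d)"
      using i by simp
    also have "\<dots> = (\<Sum>q\<in>?Q. ?A q a b * cnj (?A q a' b') / of_nat d)"
      by (simp add: sum.Sigma case_prod_unfold)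
    also have "\<dots> = (\<Sum>q\<in>?Q. ?A q a b * cnj (?A q a' b')) / of_nat d"
      by (simp add: sum_divide_distrib)
    finally show "(\<Sum>q\<in>?Q. ?A q a b * cnj (?A q a' b')) = (if i = i' \<and> a = b \<and> a' = b' then of_nat d else 0)"
      using d by (auto simp: field_simps split: if_splits)
  qed (use i in auto)
  then show ?thesis by simp
qed

text \<open>The Kraus operators of \<open>N\<close> are matched one to one with those of
  \<open>M\<close>. Only matched pairs survive, as \<open>c j\<close> times the identity, so the
  composition multiplies by the sum of their squared moduli divided by \<open>d\<close>, which is 1
  by the last hypothesis.\<close>

lemma ent_comp_identity:
  assumes M: "kraus_family m (\<lambda>i. dX i * d) n dY M SM K"
    and N: "kraus_family n (\<lambda>j. dY j * d) m dX N SN L"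
    and S: "\<And>i j. i < m \<Longrightarrow> j < n \<Longrightarrow> SN j i = SM i j"
    and d: "0 < d"
    and \<rho>: "\<And>i. i < m \<Longrightarrow> \<rho> i \<in> carrier_mat (dX i) (dX i)"
    and i: "i < m"
    and kc: "\<And>i' j s k a b. i' < m \<Longrightarrow> j < n \<Longrightarrow> s < SN j i \<Longrightarrow> k < SM i' j \<Longrightarrow> a < dX i \<Longrightarrow> b < dX i' \<Longrightarrow>
      kcomp (dY j) d (L j i) (K i' j) s k a b = (if i = i' \<and> s = k \<and> a = b then c j else 0)"
    and c: "(\<Sum>j<n. of_nat (SN j i) * (c j * cnj (c j))) = of_nat d"
  shows "ent_comp m dX n dY d M N \<rho> i = \<rho> i"
proof (rule eq_matI)
  fix a a' assume "a < dim_row (\<rho> i)" "a' < dim_col (\<rho> i)"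
  then have a: "a < dX i" "a' < dX i" using \<rho>[OF i] by auto
  have "ent_comp m dX n dY d M N \<rho> i $$ (a, a') =
     (\<Sum>j<n. \<Sum>s<SN j i. \<Sum>i'<m. \<Sum>k<SM i' j. \<Sum>b<dX i'. \<Sum>b'<dX i'.
        (if i = i' \<and> s = k \<and> a = b then c j else 0) * (\<rho> i' $$ (b, b') / of_nat d)
        * cnj (if i = i' \<and> s = k \<and> a' = b' then c j else 0))"
    by (subst ent_comp_index[OF M N _ i a], erule \<rho>, intro sum.cong refl) (use a in \<open>simp add: kc\<close>)
  also have "\<dots> = (\<Sum>j<n. \<Sum>s<SN j i. \<Sum>i'<m. \<Sum>k<SM i' j. \<Sum>b<dX i'. \<Sum>b'<dX i'.
        if b' = a' then (if b = a then (if k = s then (if i' = i then c j * cnj (c j) * (\<rho> i $$ (a, a') / of_nat d) else 0) else 0) else 0) else 0)"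
    by (intro sum.cong refl) (auto simp: mult_ac)
  also have "\<dots> = (\<Sum>j<n. \<Sum>s<SN j i. \<Sum>i'<m. if i' = i then c j * cnj (c j) * (\<rho> i $$ (a, a') / of_nat d) else 0)"
  proof (intro sum.cong refl)
    fix j s i' assume "j \<in> {..<n}" "s \<in> {..<SN j i}" "i' \<in> {..<m}"
    then show "(\<Sum>k<SM i' j. \<Sum>b<dX i'. \<Sum>b'<dX i'.
        if b' = a' then (if b = a then (if k = s then (if i' = i then c j * cnj (c j) * (\<rho> i $$ (a, a') / of_nat d) else 0) else 0) else 0) else 0)
      = (if i' = i then c j * cnj (c j) * (\<rho> i $$ (a, a') / of_nat d) else 0)"
      using a S i by (cases "i' = i") (simp_all cong: if_cong)
  qed
  also have "\<dots> = (\<Sum>j<n. of_nat (SN j i) * (c j * cnj (c j))) * (\<rho> i $$ (a, a') / of_nat d)"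
    using i by (simp add: sum_distrib_right sum_divide_distrib mult.assoc)
  also have "\<dots> = \<rho> i $$ (a, a')" unfolding c using d by simp
  finally show "ent_comp m dX n dY d M N \<rho> i $$ (a, a') = \<rho> i $$ (a, a')" .
qed (use \<rho>[OF i] in \<open>auto simp: apply_map_def msum_def\<close>)

lemma channel_kraus:
  assumes "is_channel n dIn m dOut N"
  shows "\<exists>S L. kraus_family n dIn m dOut N S L"
proof -
  have "\<forall>j i. \<exists>S L. j < n \<longrightarrow> i < m \<longrightarrow> (\<forall>P\<in>carrier_mat (dIn j) (dIn j). N j i P = kraus_map (dOut i) (dIn j) S L P)"
  proof (intro allI)
    fix j i
    show "\<exists>S L. j < n \<longrightarrow> i < m \<longrightarrow> (\<forall>P\<in>carrier_mat (dIn j) (dIn j). N j i P = kraus_map (dOut i) (dIn j) S L P)"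
    proof (cases "j < n \<and> i < m")
      case True
      then have "lin_map (dIn j) (dOut i) (N j i)" "compl_pos (dIn j) (dOut i) (N j i)"
        using assms by (simp_all add: is_channel_def)
      from compl_pos_kraus[OF this] show ?thesis by blast
    qed auto
  qed
  then show ?thesis unfolding choice_iff kraus_family_def by blast
qed

subsection \<open>Kraus operators of an inverse pair\<close>

text \<open>This is v = u^dagger (u v) for the isometry obtained by stacking all rows (j, y, k).
  Since u v is supported on the rows (j0, y0, k), only these contribute.\<close>

lemma isometry_recover:
  fixes u :: "nat \<Rightarrow> nat \<Rightarrow> nat \<Rightarrow> nat \<Rightarrow> nat \<Rightarrow> complex"
  assumes iso: "\<And>x x' h h'. x < dx \<Longrightarrow> x' < dx \<Longrightarrow> h < d \<Longrightarrow> h' < d \<Longrightarrow>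
      (\<Sum>j<n. \<Sum>y<dY j. \<Sum>k<e j. cnj (u j y k x h) * u j y k x' h') = (if x = x' \<and> h = h' then 1 else 0)"
    and g: "\<And>j y k. j < n \<Longrightarrow> y < dY j \<Longrightarrow> k < e j \<Longrightarrow>
      (\<Sum>x<dx. \<Sum>h<d. u j y k x h * v x h) = (if j = j0 \<and> y = y0 then c k else 0)"
    and lt: "j0 < n" "y0 < dY j0" "x < dx" "h < d"
  shows "v x h = (\<Sum>k<e j0. cnj (u j0 y0 k x h) * c k)"
proof -
  let ?Q = "SIGMA j:{..<n}. {..<dY j} \<times> {..<e j}"
  let ?u = "\<lambda>(j, y, k) x h. u j y k x h"
  have nest: "(\<Sum>j<n. \<Sum>y<dY j. \<Sum>k<e j. f j y k) = (\<Sum>(j, y, k)\<in>?Q. f j y k)" for f :: "nat \<Rightarrow> nat \<Rightarrow> nat \<Rightarrow> complex"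
    by (simp add: sum.Sigma case_prod_unfold)
  have "v x h = (\<Sum>x'<dx. \<Sum>h'<d. if h' = h then (if x' = x then v x' h' else 0) else 0)"
    using lt by simp
  also have "\<dots> = (\<Sum>x'<dx. \<Sum>h'<d. (\<Sum>j<n. \<Sum>y<dY j. \<Sum>k<e j. cnj (u j y k x h) * u j y k x' h') * v x' h')"
    using lt by (intro sum.cong refl) (simp add: iso)
  also have "\<dots> = (\<Sum>x'<dx. \<Sum>h'<d. \<Sum>q\<in>?Q. cnj (?u q x h) * (?u q x' h' * v x' h'))"
    unfolding nest by (simp add: sum_distrib_right case_prod_unfold mult.assoc)
  also have "\<dots> = (\<Sum>q\<in>?Q. \<Sum>x'<dx. \<Sum>h'<d. cnj (?u q x h) * (?u q x' h' * v x' h'))"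
    by (rule trans[OF sum.cong[OF refl sum.swap] sum.swap])
  also have "\<dots> = (\<Sum>(j, y, k)\<in>?Q. cnj (u j y k x h) * (\<Sum>x'<dx. \<Sum>h'<d. u j y k x' h' * v x' h'))"
    by (simp add: sum_distrib_left case_prod_unfold)
  also have "\<dots> = (\<Sum>j<n. \<Sum>y<dY j. \<Sum>k<e j. cnj (u j y k x h) * (\<Sum>x'<dx. \<Sum>h'<d. u j y k x' h' * v x' h'))"
    by (rule nest[symmetric])
  also have "\<dots> = (\<Sum>j<n. \<Sum>y<dY j. if y = y0 then (if j = j0 then \<Sum>k<e j. cnj (u j y k x h) * c k else 0) else 0)"
    by (intro sum.cong refl) (simp add: g)
  also have "\<dots> = (\<Sum>j<n. if j = j0 then (\<Sum>y<dY j. if y = y0 then \<Sum>k<e j. cnj (u j y k x h) * c k else 0) else 0)"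
    by (intro sum.cong refl) simp
  also have "\<dots> = (\<Sum>k<e j0. cnj (u j0 y0 k x h) * c k)"
    using lt by simp
  finally show ?thesis .
qed

text \<open>The vectors \<open>g k\<close>, indexed by \<open>s\<close>, are orthogonal with squared
  norm \<open>c\<close>. Hence mixing a Kraus family with the coefficients \<open>g\<close>
  multiplies its map by \<open>c\<close>.\<close>

lemma sum_gram_contract:
  fixes a b :: "nat \<Rightarrow> complex"
  assumes "\<And>k k'. k < e \<Longrightarrow> k' < e \<Longrightarrow> (\<Sum>s<S. cnj (g k' s) * g k s) = (if k' = k then c else 0)"
  shows "(\<Sum>s<(S::nat). (\<Sum>k<(e::nat). a k * g k s) * (\<Sum>k<e. b k * cnj (g k s))) = c * (\<Sum>k<e. a k * b k)"
proof -
  have "(\<Sum>s<S. (\<Sum>k<e. a k * g k s) * (\<Sum>k<e. b k * cnj (g k s)))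
      = (\<Sum>s<S. \<Sum>k<e. \<Sum>k'<e. a k * b k' * (cnj (g k' s) * g k s))"
    unfolding sum_product by (intro sum.cong refl) (simp add: mult_ac)
  also have "\<dots> = (\<Sum>k<e. \<Sum>k'<e. \<Sum>s<S. a k * b k' * (cnj (g k' s) * g k s))"
    by (rule trans[OF sum.swap sum.cong[OF refl sum.swap]])
  also have "\<dots> = (\<Sum>k<e. \<Sum>k'<e. if k' = k then a k * b k * c else 0)"
    by (intro sum.cong refl) (simp add: assms flip: sum_distrib_left)
  also have "\<dots> = c * (\<Sum>k<e. a k * b k)"
    by (simp add: sum_distrib_left mult_ac)
  finally show ?thesis .
qed

text \<open>Entries of Kraus operators \<open>t\<close> of \<open>M\<close> and \<open>l\<close> of \<open>N\<close>; \<open>lam\<close> and \<open>mu\<close> are the scalars to which the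
Kraus operators of the two compositions reduce.\<close>
locale kraus_pair =
  fixes m n d :: nat and dX dY :: "nat \<Rightarrow> nat" and E S :: "nat \<Rightarrow> nat \<Rightarrow> nat"
    and t l :: "nat \<Rightarrow> nat \<Rightarrow> nat \<Rightarrow> nat \<Rightarrow> nat \<Rightarrow> nat \<Rightarrow> complex"
    and lam mu :: "nat \<Rightarrow> nat \<Rightarrow> nat \<Rightarrow> nat \<Rightarrow> complex"
  assumes posX: "i < m \<Longrightarrow> 0 < dX i" and posY: "j < n \<Longrightarrow> 0 < dY j"
    and iso_t: "\<lbrakk>i < m; x < dX i; x' < dX i; h < d; h' < d\<rbrakk> \<Longrightarrow>
      (\<Sum>j<n. \<Sum>y<dY j. \<Sum>k<E j i. cnj (t i j k y x h) * t i j k y x' h') = (if x = x' \<and> h = h' then 1 else 0)"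
    and iso_l: "\<lbrakk>j < n; y < dY j; y' < dY j; h < d; h' < d\<rbrakk> \<Longrightarrow>
      (\<Sum>i<m. \<Sum>x<dX i. \<Sum>s<S j i. cnj (l j i s x y h) * l j i s x y' h') = (if y = y' \<and> h = h' then 1 else 0)"
    and comp_lt: "\<lbrakk>i < m; i' < m; j < n; s < S j i; k < E j i'; a < dX i; b < dX i'\<rbrakk> \<Longrightarrow>
      (\<Sum>y<dY j. \<Sum>h<d. l j i s a y h * t i' j k y b h) = (if i = i' \<and> a = b then lam j i s k else 0)"
    and comp_tl: "\<lbrakk>i < m; j' < n; j < n; k < E j' i; s < S j i; z < dY j'; y < dY j\<rbrakk> \<Longrightarrow>
      (\<Sum>x<dX i. \<Sum>h<d. t i j' k z x h * l j i s x y h) = (if j' = j \<and> z = y then mu i j k s else 0)"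
    and indep: "\<lbrakk>i < m; j < n; \<And>y x h. y < dY j \<Longrightarrow> x < dX i \<Longrightarrow> h < d \<Longrightarrow> (\<Sum>k<E j i. c k * t i j k y x h) = 0; k < E j i\<rbrakk>
      \<Longrightarrow> c k = 0"
begin

text \<open>The two products have the same trace because either one is the full contraction of
  \<open>l\<close> with \<open>t\<close> over a, y and h.\<close>

lemma mu_lam:
  assumes "i < m" "j < n" "s < S j i" "k < E j i"
  shows "mu i j k s = of_nat (dX i) / of_nat (dY j) * lam j i s k"
proof -
  have "of_nat (dX i) * lam j i s k = (\<Sum>a<dX i. \<Sum>y<dY j. \<Sum>h<d. l j i s a y h * t i j k y a h)"
    using assms by (simp add: comp_lt)
  also have "\<dots> = (\<Sum>y<dY j. \<Sum>a<dX i. \<Sum>h<d. l j i s a y h * t i j k y a h)"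
    by (rule sum.swap)
  also have "\<dots> = (\<Sum>y<dY j. \<Sum>a<dX i. \<Sum>h<d. t i j k y a h * l j i s a y h)"
    by (simp add: mult.commute)
  also have "\<dots> = of_nat (dY j) * mu i j k s"
    using assms by (simp add: comp_tl)
  finally show ?thesis using posY[OF assms(2)] by (simp add: field_simps)
qed

text \<open>The isometry is the stack of the \<open>t i j k\<close>, that is, trace preservation of
  \<open>M\<close>; \<open>comp_tl\<close> says that it sends the slice of \<open>l\<close> at fixed
  y into the rows (j, y, k).\<close>

lemma l_eq:
  assumes "i < m" "j < n" "s < S j i" "x < dX i" "y < dY j" "h < d"
  shows "l j i s x y h = (\<Sum>k<E j i. cnj (t i j k y x h) * mu i j k s)"
  by (rule isometry_recover[where u = "\<lambda>j y k x h. t i j k y x h" and v = "\<lambda>x h. l j i s x y h"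
        and dx = "dX i" and d = d and n = n and dY = dY and e = "\<lambda>j. E j i" and c = "\<lambda>k. mu i j k s"])
    (use assms in \<open>simp_all add: iso_t comp_tl\<close>)

text \<open>The mirror image of \<open>l_eq\<close>: now the isometry comes from trace preservation
  of \<open>N\<close>, and \<open>comp_lt\<close> locates the support.\<close>

lemma t_eq:
  assumes "i < m" "j < n" "k < E j i" "x < dX i" "y < dY j" "h < d"
  shows "t i j k y x h = (\<Sum>s<S j i. cnj (l j i s x y h) * lam j i s k)"
  by (rule isometry_recover[where u = "\<lambda>i x s y h. l j i s x y h" and v = "\<lambda>y h. t i j k y x h"
        and dx = "dY j" and d = d and n = m and dY = dX and e = "\<lambda>i. S j i" and c = "\<lambda>s. lam j i s k"])
    (use assms in \<open>auto simp: iso_l comp_lt\<close>)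

lemma gram_mu_lam:
  assumes "i < m" "j < n" "k < E j i" "k' < E j i"
  shows "(\<Sum>s<S j i. cnj (mu i j k' s) * lam j i s k) = (if k' = k then 1 else 0)"
proof -
  \<comment> \<open>The coefficients of t_k as a combination of all t_p, obtained from
    \<open>t_eq\<close> followed by \<open>l_eq\<close>, minus those of the trivial
    combination.\<close>
  define c where "c k' = (\<Sum>s<S j i. cnj (mu i j k' s) * lam j i s k) - (if k' = k then 1 else 0)" for k'
  have "(\<Sum>p<E j i. c p * t i j p y x h) = 0" if "y < dY j" "x < dX i" "h < d" for y x h
  proof -
    have "t i j k y x h = (\<Sum>s<S j i. \<Sum>p<E j i. cnj (mu i j p s) * lam j i s k * t i j p y x h)"
      unfolding t_eq[OF assms(1-3) that(2,1,3)]
      using assms that by (intro sum.cong refl) (simp add: l_eq sum_distrib_left sum_distrib_right mult_ac)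
    also have "\<dots> = (\<Sum>p<E j i. (\<Sum>s<S j i. cnj (mu i j p s) * lam j i s k) * t i j p y x h)"
      unfolding sum_distrib_right by (rule sum.swap)
    finally have *: "(\<Sum>p<E j i. (\<Sum>s<S j i. cnj (mu i j p s) * lam j i s k) * t i j p y x h) = t i j k y x h" ..
    have "(\<Sum>p<E j i. (if p = k then 1 else 0) * t i j p y x h) = (\<Sum>p<E j i. if p = k then t i j p y x h else 0)"
      by (intro sum.cong refl) simp
    then have "(\<Sum>p<E j i. (if p = k then 1 else 0) * t i j p y x h) = t i j k y x h"
      using assms by simp
    with * show ?thesis by (simp add: c_def left_diff_distrib sum_subtractf)
  qed
  from indep[where c = c, OF assms(1,2) this assms(4)] show ?thesis by (simp add: c_def)
qed

lemma gram_lam: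
  assumes "i < m" "j < n" "k < E j i" "k' < E j i"
  shows "(\<Sum>s<S j i. cnj (lam j i s k') * lam j i s k) = (if k' = k then of_nat (dY j) / of_nat (dX i) else 0)"
proof -
  have "(\<Sum>s<S j i. cnj (mu i j k' s) * lam j i s k)
      = of_nat (dX i) / of_nat (dY j) * (\<Sum>s<S j i. cnj (lam j i s k') * lam j i s k)"
    unfolding sum_distrib_left using assms by (intro sum.cong refl) (simp add: mu_lam)
  then show ?thesis using gram_mu_lam[OF assms] posX[OF assms(1)] posY[OF assms(2)]
    by (auto simp: field_simps split: if_splits)
qed

lemma gram_mu:
  assumes "i < m" "j < n" "k < E j i" "k' < E j i"
  shows "(\<Sum>s<S j i. cnj (mu i j k' s) * mu i j k s) = (if k' = k then of_nat (dX i) / of_nat (dY j) else 0)"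
proof -
  have "(\<Sum>s<S j i. cnj (mu i j k' s) * mu i j k s)
      = of_nat (dX i) / of_nat (dY j) * (\<Sum>s<S j i. cnj (mu i j k' s) * lam j i s k)"
    unfolding sum_distrib_left using assms by (intro sum.cong refl) (simp add: mu_lam[where k = k])
  then show ?thesis using gram_mu_lam[OF assms] by simp
qed

lemma cnj_t_eq:
  assumes "i < m" "j < n" "k < E j i" "x < dX i" "y < dY j" "h < d"
  shows "cnj (t i j k y x h) = (\<Sum>s<S j i. cnj (lam j i s k) * l j i s x y h)"
  unfolding t_eq[OF assms] by (simp add: mult.commute)

text \<open>The half U_i U_i^dagger = 1. Writing the conjugated factor through \<open>l\<close>
  reduces the sum to \<open>comp_tl\<close> and then to \<open>gram_mu_lam\<close>.\<close>

lemma t_rows: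
  assumes "i < m" "j < n" "k < E j i" "y < dY j" "j' < n" "k' < E j' i" "y' < dY j'"
  shows "(\<Sum>x<dX i. \<Sum>h<d. t i j k y x h * cnj (t i j' k' y' x h)) = (if j = j' \<and> y = y' \<and> k = k' then 1 else 0)"
proof -
  have "(\<Sum>x<dX i. \<Sum>h<d. t i j k y x h * cnj (t i j' k' y' x h))
     = (\<Sum>x<dX i. \<Sum>h<d. \<Sum>s<S j' i. cnj (lam j' i s k') * (t i j k y x h * l j' i s x y' h))"
    using assms by (intro sum.cong refl) (simp add: cnj_t_eq sum_distrib_left mult_ac)
  also have "\<dots> = (\<Sum>s<S j' i. \<Sum>x<dX i. \<Sum>h<d. cnj (lam j' i s k') * (t i j k y x h * l j' i s x y' h))"
    by (rule trans[OF sum.cong[OF refl sum.swap] sum.swap])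
  also have "\<dots> = (\<Sum>s<S j' i. cnj (lam j' i s k') * (if j = j' \<and> y = y' then mu i j' k s else 0))"
    using assms by (intro sum.cong refl) (simp add: comp_tl flip: sum_distrib_left)
  also have "\<dots> = (if j = j' \<and> y = y' \<and> k = k' then 1 else 0)"
  proof (cases "j = j' \<and> y = y'")
    case True
    with assms have k: "k' < E j i" by simp
    show ?thesis
      using arg_cong[OF gram_mu_lam[OF assms(1,2) k assms(3)], of cnj] True by (auto simp: mult.commute)
  qed auto
  finally show ?thesis .
qed

text \<open>The half W_j^dagger W_j = 1 before rescaling: \<open>comp_lt\<close> evaluates the sums
  and \<open>gram_lam\<close> supplies the factor dim Y_j / dim X_i.\<close>

lemma pt_cols:
  assumes "j < n" "i < m" "k < E j i" "x < dX i" "i' < m" "k' < E j i'" "x' < dX i'"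
  shows "(\<Sum>y<dY j. \<Sum>h<d. cnj (t i j k y x h) * t i' j k' y x' h)
    = (if i = i' \<and> x = x' \<and> k = k' then of_nat (dY j) / of_nat (dX i) else 0)"
proof -
  have "(\<Sum>y<dY j. \<Sum>h<d. cnj (t i j k y x h) * t i' j k' y x' h)
     = (\<Sum>y<dY j. \<Sum>h<d. \<Sum>s<S j i. cnj (lam j i s k) * (l j i s x y h * t i' j k' y x' h))"
    using assms by (intro sum.cong refl) (simp add: cnj_t_eq sum_distrib_left sum_distrib_right mult_ac)
  also have "\<dots> = (\<Sum>s<S j i. \<Sum>y<dY j. \<Sum>h<d. cnj (lam j i s k) * (l j i s x y h * t i' j k' y x' h))"
    by (rule trans[OF sum.cong[OF refl sum.swap] sum.swap])
  also have "\<dots> = (\<Sum>s<S j i. cnj (lam j i s k) * (if i = i' \<and> x = x' then lam j i s k' else 0))"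
    using assms by (intro sum.cong refl) (simp add: comp_lt flip: sum_distrib_left)
  also have "\<dots> = (if i = i' \<and> x = x' \<and> k = k' then of_nat (dY j) / of_nat (dX i) else 0)"
  proof (cases "i = i' \<and> x = x'")
    case True
    then show ?thesis using gram_lam[of i j k' k] assms by auto
  qed auto
  finally show ?thesis .
qed

text \<open>The left side determines the component of \<open>N\<close>, and the right side involves
  \<open>M\<close> alone. The formula for \<open>N\<close> and its uniqueness both rest on
  this.\<close>

lemma l_gram:
  assumes "i < m" "j < n" "x < dX i" "y < dY j" "h < d" "x' < dX i" "y' < dY j" "h' < d"
  shows "(\<Sum>s<S j i. l j i s x y h * cnj (l j i s x' y' h'))
    = of_nat (dX i) / of_nat (dY j) * (\<Sum>k<E j i. cnj (t i j k y x h) * t i j k y' x' h')"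
proof -
  have "(\<Sum>s<S j i. l j i s x y h * cnj (l j i s x' y' h'))
    = (\<Sum>s<S j i. (\<Sum>k<E j i. cnj (t i j k y x h) * mu i j k s) * (\<Sum>k<E j i. t i j k y' x' h' * cnj (mu i j k s)))"
    using assms by (intro sum.cong refl) (simp add: l_eq)
  also have "\<dots> = of_nat (dX i) / of_nat (dY j) * (\<Sum>k<E j i. cnj (t i j k y x h) * t i j k y' x' h')"
    by (rule sum_gram_contract) (use assms in \<open>simp add: gram_mu\<close>)
  finally show ?thesis .
qed

text \<open>The half W_j W_j^dagger = 1: through \<open>l_gram\<close> it becomes trace preservation
  of \<open>N\<close>.\<close>

lemma pt_rows:
  assumes "j < n" "y < dY j" "h < d" "y' < dY j" "h' < d"
  shows "(\<Sum>i<m. \<Sum>x<dX i. \<Sum>k<E j i. of_nat (dX i) / of_nat (dY j) * (t i j k y x h * cnj (t i j k y' x h')))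
    = (if y = y' \<and> h = h' then 1 else 0)"
proof -
  have "(\<Sum>i<m. \<Sum>x<dX i. \<Sum>k<E j i. of_nat (dX i) / of_nat (dY j) * (t i j k y x h * cnj (t i j k y' x h')))
     = (\<Sum>i<m. \<Sum>x<dX i. \<Sum>s<S j i. l j i s x y' h' * cnj (l j i s x y h))"
    using assms by (intro sum.cong[OF refl sum.cong[OF refl]]) (simp add: l_gram sum_distrib_left mult.commute)
  also have "\<dots> = (if y = y' \<and> h = h' then 1 else 0)"
    using iso_l[OF assms(1,2,4,3,5)] by (simp add: mult.commute)
  finally show ?thesis .
qed

end

subsection \<open>Trace preservation and unitary block matrices\<close>

lemma sum_swap_nested:
  fixes f :: "nat \<Rightarrow> nat \<Rightarrow> nat \<Rightarrow> nat \<Rightarrow> nat \<Rightarrow> complex"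
  shows "(\<Sum>j<n. \<Sum>y<a j. \<Sum>k<e j. \<Sum>x<p. \<Sum>h<q. f j y k x h) = (\<Sum>x<p. \<Sum>h<q. \<Sum>j<n. \<Sum>y<a j. \<Sum>k<e j. f j y k x h)"
proof -
  let ?Q = "SIGMA j:{..<n}. {..<a j} \<times> {..<e j}"
  have nest: "(\<Sum>j<n. \<Sum>y<a j. \<Sum>k<e j. f j y k) = (\<Sum>(j, y, k)\<in>?Q. f j y k)" for f :: "nat \<Rightarrow> nat \<Rightarrow> nat \<Rightarrow> complex"
    by (simp add: sum.Sigma case_prod_unfold)
  show ?thesis unfolding nest case_prod_unfold
    by (rule trans[OF sum.swap sum.cong[OF refl sum.swap]])
qed

lemma kraus_trace:
  fixes dX :: "nat \<Rightarrow> nat"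
  shows "(\<Sum>i<m. mtrace (kraus_map (dX i) D (S i) (L i) P))
    = (\<Sum>r<D. \<Sum>q<D. P $$ (r, q) * (\<Sum>i<m. \<Sum>x<dX i. \<Sum>s<S i. cnj (L i s x q) * L i s x r))"
proof -
  have "(\<Sum>i<m. mtrace (kraus_map (dX i) D (S i) (L i) P))
     = (\<Sum>i<m. \<Sum>x<dX i. \<Sum>s<S i. \<Sum>r<D. \<Sum>q<D. P $$ (r, q) * (cnj (L i s x q) * L i s x r))"
    by (simp add: mtrace_def kraus_map_def mult_ac)
  also have "\<dots> = (\<Sum>r<D. \<Sum>q<D. \<Sum>i<m. \<Sum>x<dX i. \<Sum>s<S i. P $$ (r, q) * (cnj (L i s x q) * L i s x r))"
    by (rule sum_swap_nested)
  finally show ?thesis by (simp add: sum_distrib_left)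
qed

text \<open>The total trace of the images is the pairing of \<open>P\<close> with the sum of all
  L_s^dagger L_s, whose entries are recovered by testing on matrix units.\<close>

lemma kraus_trace_preserving_iff:
  fixes dX :: "nat \<Rightarrow> nat"
  shows "(\<forall>P\<in>carrier_mat D D. (\<Sum>i<m. mtrace (kraus_map (dX i) D (S i) (L i) P)) = mtrace P) \<longleftrightarrow>
   (\<forall>r<D. \<forall>q<D. (\<Sum>i<m. \<Sum>x<dX i. \<Sum>s<S i. cnj (L i s x r) * L i s x q) = (if r = q then 1 else 0))"
  (is "?A \<longleftrightarrow> ?B")
proof
  assume A: ?A
  show ?B
  proof (intro allI impI)
    fix r q assume rq: "r < D" "q < D"
    \<comment> \<open>The pairing transposes: the entry (r, q) is read off with the matrix unit at
      (q, r).\<close>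
    let ?G = "\<lambda>a b. \<Sum>i<m. \<Sum>x<dX i. \<Sum>s<S i. cnj (L i s x b) * L i s x a"
    have "(\<Sum>a<D. \<Sum>b<D. eunit D q r $$ (a, b) * ?G a b) = (\<Sum>a<D. \<Sum>b<D. if b = r then (if a = q then ?G a b else 0) else 0)"
      by (intro sum.cong refl) simp
    also have "\<dots> = ?G q r" using rq by simp
    finally have "?G q r = mtrace (eunit D q r)"
      using A[rule_format, of "eunit D q r"] unfolding kraus_trace by simp
    also have "\<dots> = (\<Sum>a<D. if a = q then (if q = r then 1 else 0) else 0)"
      unfolding mtrace_def by (rule sum.cong) (auto simp: eunit_def)
    also have "\<dots> = (if r = q then 1 else 0)"
      using rq by simp
    finally show "?G q r = (if r = q then 1 else 0)" .
  qed
next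
  assume B: ?B
  show ?A
  proof
    fix P :: "complex mat" assume P: "P \<in> carrier_mat D D"
    have "(\<Sum>i<m. mtrace (kraus_map (dX i) D (S i) (L i) P)) = (\<Sum>r<D. \<Sum>q<D. if q = r then P $$ (r, q) else 0)"
      unfolding kraus_trace using B by (intro sum.cong refl) simp
    then show "(\<Sum>i<m. mtrace (kraus_map (dX i) D (S i) (L i) P)) = mtrace P"
      using P by (simp add: mtrace_def)
  qed
qed

section \<open>Matrix products, unitarity and block matrices in coordinates\<close>

lemma mult_index_sum:
  assumes "A \<in> carrier_mat a b" "B \<in> carrier_mat b c" "p < a" "q < c"
  shows "(A * B) $$ (p, q) = (\<Sum>r<b. A $$ (p, r) * B $$ (r, q))"
  using assms by (auto simp: scalar_prod_def atLeast0LessThan intro!: sum.cong)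

lemma mult3_index_sum:
  fixes A :: "complex mat"
  assumes "A \<in> carrier_mat a b" "P \<in> carrier_mat b c" "B \<in> carrier_mat c e" "p < a" "q < e"
  shows "(A * P * B) $$ (p, q) = (\<Sum>r<b. \<Sum>s<c. A $$ (p, r) * P $$ (r, s) * B $$ (s, q))"
proof -
  have "(A * P * B) $$ (p, q) = (\<Sum>s<c. (\<Sum>r<b. A $$ (p, r) * P $$ (r, s)) * B $$ (s, q))"
    using assms by (subst mult_index_sum[of _ a c _ e]) (auto simp: mult_index_sum[of _ a b _ c] simp del: index_mult_mat(1))
  also have "\<dots> = (\<Sum>s<c. \<Sum>r<b. A $$ (p, r) * P $$ (r, s) * B $$ (s, q))"
    by (simp add: sum_distrib_right)
  finally show ?thesis by (simp add: sum.swap[of _ "{..<c}"])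
qed

lemma adj_carrier: "A \<in> carrier_mat a b \<Longrightarrow> adj A \<in> carrier_mat b a"
  by (simp add: adj_def)

lemma adj_index: "A \<in> carrier_mat a b \<Longrightarrow> p < b \<Longrightarrow> q < a \<Longrightarrow> adj A $$ (p, q) = cnj (A $$ (q, p))"
  by (simp add: adj_def)

lemma unitary_mat_iff:
  assumes V: "V \<in> carrier_mat R C"
  shows "unitary_mat V \<longleftrightarrow>
    (\<forall>c<C. \<forall>c'<C. (\<Sum>q<R. cnj (V $$ (q, c)) * V $$ (q, c')) = (if c = c' then 1 else 0)) \<and>
    (\<forall>q<R. \<forall>q'<R. (\<Sum>c<C. V $$ (q, c) * cnj (V $$ (q', c))) = (if q = q' then 1 else 0))"
proof -
  note adj = adj_carrier[OF V]
  have eq: "A = 1\<^sub>m D \<longleftrightarrow> (\<forall>c<D. \<forall>c'<D. A $$ (c, c') = (if c = c' then 1 else 0))"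
    if "A \<in> carrier_mat D D" for A :: "complex mat" and D
    using that by (auto simp: mat_eq_iff)
  have 1: "(adj V * V) $$ (c, c') = (\<Sum>q<R. cnj (V $$ (q, c)) * V $$ (q, c'))" if "c < C" "c' < C" for c c'
    using that mult_index_sum[OF adj V that] by (simp add: adj_index[OF V])
  have 2: "(V * adj V) $$ (q, q') = (\<Sum>c<C. V $$ (q, c) * cnj (V $$ (q', c)))" if "q < R" "q' < R" for q q'
    using that mult_index_sum[OF V adj that] by (simp add: adj_index[OF V])
  have "adj V * V \<in> carrier_mat C C" "V * adj V \<in> carrier_mat R R" using V adj by auto
  then show ?thesis
    unfolding unitary_mat_def using V by (simp add: eq 1 2 del: index_mult_mat(1))
qed

lemma sum_block_index:
  fixes f :: "nat \<Rightarrow> 'a::comm_monoid_add" and d :: "nat \<Rightarrow> nat"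
  shows "(\<Sum>q<(\<Sum>j<N. d j). f q) = (\<Sum>j<N. \<Sum>r<d j. f ((\<Sum>p<j. d p) + r))"
proof (induction N)
  case (Suc N)
  have split: "(\<Sum>r<c + b. f r) = (\<Sum>r<c. f r) + (\<Sum>k<b. f (c + k))" for b c
    by (induction b) (simp_all add: add.assoc)
  show ?case using Suc by (simp add: split)
qed simp

lemma block_index_less:
  fixes d :: "nat \<Rightarrow> nat"
  assumes "j < N" "r < d j"
  shows "(\<Sum>p<j. d p) + r < (\<Sum>p<N. d p)"
proof -
  have "(\<Sum>p<j. d p) + r < (\<Sum>p<Suc j. d p)" using assms by simp
  also have "\<dots> \<le> (\<Sum>p<N. d p)" using assms by (intro sum_mono2) auto
  finally show ?thesis .
qed

lemma block_index_eq:
  fixes d :: "nat \<Rightarrow> nat"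
  assumes "r < d j" "r' < d j'"
  shows "(\<Sum>p<j. d p) + r = (\<Sum>p<j'. d p) + r' \<longleftrightarrow> j = j' \<and> r = r'"
proof (cases j j' rule: linorder_cases)
  case less
  then show ?thesis using block_index_less[of j j' r d] assms by simp
next
  case greater
  then show ?thesis using block_index_less[of j' j r' d] assms by simp
qed simp

lemma all_block_index:
  fixes d :: "nat \<Rightarrow> nat"
  shows "(\<forall>q<(\<Sum>j<N. d j). Q q) \<longleftrightarrow> (\<forall>j<N. \<forall>r<d j. Q ((\<Sum>p<j. d p) + r))"
proof (induction N)
  case (Suc N)
  have "(\<forall>q<c + b. Q q) \<longleftrightarrow> (\<forall>q<c. Q q) \<and> (\<forall>r<b. Q (c + r))" for b c :: nat
    by (metis add_less_cancel_left le_add_diff_inverse not_less trans_less_add1)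
  then show ?case using Suc by (auto simp: less_Suc_eq)
qed simp

lemma all_prod_index: "(\<forall>r<a * b. Q r) \<longleftrightarrow> (\<forall>y<a. \<forall>k<(b::nat). Q (y * b + k))"
  using all_block_index[where N = a and d = "\<lambda>_. b" and Q = Q] by simp

lemma prod_index_eq: "k < b \<Longrightarrow> k' < b \<Longrightarrow> y * b + k = y' * b + k' \<longleftrightarrow> y = y' \<and> k = (k'::nat)"
  using block_index_eq[of k "\<lambda>_. b" y k' y'] by (simp add: mult.commute)

lemma vstack_carrier:
  "(\<And>j. j < N \<Longrightarrow> b j \<in> carrier_mat (d j) nc) \<Longrightarrow> vstack nc b N \<in> carrier_mat (\<Sum>j<N. d j) nc"
  by (induction N) auto

lemma vstack_index:
  "(\<And>j. j < N \<Longrightarrow> b j \<in> carrier_mat (d j) nc) \<Longrightarrow> j < N \<Longrightarrow> r < d j \<Longrightarrow> c < nc \<Longrightarrow>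
    vstack nc b N $$ ((\<Sum>p<j. d p) + r, c) = b j $$ (r, c)"
proof (induction N)
  case (Suc N)
  have V: "vstack nc b N \<in> carrier_mat (\<Sum>j<N. d j) nc" using Suc.prems by (intro vstack_carrier) auto
  have B: "b N \<in> carrier_mat (d N) nc" using Suc.prems by simp
  show ?case
  proof (cases "j = N")
    case True
    then show ?thesis using carrier_matD[OF V] carrier_matD[OF B] Suc.prems(3,4) by (simp add: append_rows_def)
  next
    case False
    then have j: "j < N" using Suc.prems by simp
    have "(\<Sum>p<j. d p) + r < (\<Sum>p<N. d p)" using j Suc.prems(3) by (rule block_index_less)
    then show ?thesis using carrier_matD[OF V] carrier_matD[OF B] j Suc by (simp add: append_rows_def)
  qed
qed simp

lemma hstack_carrier:
  "(\<And>i. i < N \<Longrightarrow> b i \<in> carrier_mat nr (d i)) \<Longrightarrow> hstack nr b N \<in> carrier_mat nr (\<Sum>i<N. d i)"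
proof (induction N)
  case (Suc N)
  then have "hstack nr b N \<in> carrier_mat nr (\<Sum>i<N. d i)" "b N \<in> carrier_mat nr (d N)" by simp_all
  then show ?case by auto
qed simp

lemma hstack_index:
  "(\<And>i. i < N \<Longrightarrow> b i \<in> carrier_mat nr (d i)) \<Longrightarrow> i < N \<Longrightarrow> c < d i \<Longrightarrow> r < nr \<Longrightarrow>
    hstack nr b N $$ (r, (\<Sum>p<i. d p) + c) = b i $$ (r, c)"
proof (induction N)
  case (Suc N)
  have V: "hstack nr b N \<in> carrier_mat nr (\<Sum>i<N. d i)" using Suc.prems by (intro hstack_carrier) auto
  have B: "b N \<in> carrier_mat nr (d N)" using Suc.prems by simp
  show ?case
  proof (cases "i = N")
    case True
    then show ?thesis using carrier_matD[OF V] carrier_matD[OF B] Suc.prems(3,4) by simp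
  next
    case False
    then have i: "i < N" using Suc.prems by simp
    have "(\<Sum>p<i. d p) + c < (\<Sum>p<N. d p)" using i Suc.prems(3) by (rule block_index_less)
    then show ?thesis using carrier_matD[OF V] carrier_matD[OF B] i Suc by simp
  qed
qed simp

lemma unitary_vstack_iff:
  assumes b: "\<And>j. j < N \<Longrightarrow> b j \<in> carrier_mat (d j) nc"
  shows "unitary_mat (vstack nc b N) \<longleftrightarrow>
    (\<forall>c<nc. \<forall>c'<nc. (\<Sum>j<N. \<Sum>r<d j. cnj (b j $$ (r, c)) * b j $$ (r, c')) = (if c = c' then 1 else 0)) \<and>
    (\<forall>j<N. \<forall>r<d j. \<forall>j'<N. \<forall>r'<d j'. (\<Sum>c<nc. b j $$ (r, c) * cnj (b j' $$ (r', c)))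
       = (if j = j' \<and> r = r' then 1 else 0))"
proof -
  have V: "vstack nc b N \<in> carrier_mat (\<Sum>j<N. d j) nc" by (rule vstack_carrier) (rule b)
  show ?thesis unfolding unitary_mat_iff[OF V] sum_block_index all_block_index
    by (simp add: vstack_index[where d = d, OF b] block_index_eq)
qed

lemma unitary_hstack_iff:
  assumes b: "\<And>i. i < N \<Longrightarrow> b i \<in> carrier_mat nr (d i)"
  shows "unitary_mat (hstack nr b N) \<longleftrightarrow>
    (\<forall>i<N. \<forall>c<d i. \<forall>i'<N. \<forall>c'<d i'. (\<Sum>r<nr. cnj (b i $$ (r, c)) * b i' $$ (r, c'))
       = (if i = i' \<and> c = c' then 1 else 0)) \<and>
    (\<forall>r<nr. \<forall>r'<nr. (\<Sum>i<N. \<Sum>c<d i. b i $$ (r, c) * cnj (b i $$ (r', c))) = (if r = r' then 1 else 0))"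
proof -
  have V: "hstack nr b N \<in> carrier_mat nr (\<Sum>i<N. d i)" by (rule hstack_carrier) (rule b)
  show ?thesis unfolding unitary_mat_iff[OF V] sum_block_index all_block_index
    by (simp add: hstack_index[where d = d, OF b] block_index_eq)
qed

subsection \<open>Minimal dilations\<close>

locale dilation =
  fixes m n dH :: nat and dX dY :: "nat \<Rightarrow> nat" and dE :: "nat \<Rightarrow> nat \<Rightarrow> nat"
    and \<tau> :: "nat \<Rightarrow> nat \<Rightarrow> complex mat"
  assumes dX_pos: "i < m \<Longrightarrow> 0 < dX i"
    and dY_pos: "j < n \<Longrightarrow> 0 < dY j"
    and dH_pos: "0 < dH"
    and dil: "minimal_dilation m dX n dY dH dE \<tau>"
    and tp: "trace_pres_dil m dX n dH \<tau>"
begin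

abbreviation M :: "nat \<Rightarrow> nat \<Rightarrow> complex mat \<Rightarrow> complex mat" where
  "M \<equiv> chanM dY dE \<tau>"

abbreviation PT :: "nat \<Rightarrow> nat \<Rightarrow> complex mat" where
  "PT i j \<equiv> ptransp (dX i) (dY j) dH (dE j i) (\<tau> i j)"

text \<open>The \<open>k\<close>-th Kraus operator $(1 \otimes \langle e_k|)\tau_{ij}$ of $M_{ij}$.\<close>
definition K :: "nat \<Rightarrow> nat \<Rightarrow> nat \<Rightarrow> nat \<Rightarrow> nat \<Rightarrow> complex" where
  "K i j k y r = \<tau> i j $$ (y * dE j i + k, r)"

text \<open>With the input index split into x and h, the same array gives both matrices: rows (y, k)
  and columns (x, h) form tau, rows (y, h) and columns (x, k) form its partial transpose.\<close>

definition t :: "nat \<Rightarrow> nat \<Rightarrow> nat \<Rightarrow> nat \<Rightarrow> nat \<Rightarrow> nat \<Rightarrow> complex" where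
  "t i j k y x h = K i j k y (x * dH + h)"

lemma tau_carrier: "i < m \<Longrightarrow> j < n \<Longrightarrow> \<tau> i j \<in> carrier_mat (dY j * dE j i) (dX i * dH)"
  using dil by (simp add: minimal_dilation_def)

lemma PT_carrier: "PT i j \<in> carrier_mat (dY j * dH) (dX i * dE j i)"
  by (simp add: ptransp_def)

lemma PT_index:
  "r < dY j * dH \<Longrightarrow> x < dX i \<Longrightarrow> k < dE j i \<Longrightarrow> PT i j $$ (r, x * dE j i + k) = t i j k (r div dH) x (r mod dH)"
  by (simp add: ptransp_def t_def K_def prod_index_less)

lemma kraus_M: "kraus_family m (\<lambda>i. dX i * dH) n dY M (\<lambda>i j. dE j i) K"
  unfolding kraus_family_def
proof (intro allI impI ballI)
  fix i j and P :: "complex mat"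
  assume ij: "i < m" "j < n" and P: "P \<in> carrier_mat (dX i * dH) (dX i * dH)"
  note T = tau_carrier[OF ij]
  show "M i j P = kraus_map (dY j) (dX i * dH) (dE j i) (K i j) P"
  proof (rule eq_matI)
    fix y y' assume "y < dim_row (kraus_map (dY j) (dX i * dH) (dE j i) (K i j) P)"
      "y' < dim_col (kraus_map (dY j) (dX i * dH) (dE j i) (K i j) P)"
    then have y: "y < dY j" "y' < dY j" by (simp_all add: kraus_map_def)
    have "M i j P $$ (y, y') = (\<Sum>k<dE j i. (\<tau> i j * P * adj (\<tau> i j)) $$ (y * dE j i + k, y' * dE j i + k))"
      using y by (simp add: chanM_def dil_comp_def ptrace2_def)
    also have "\<dots> = (\<Sum>k<dE j i. \<Sum>r<dX i * dH. \<Sum>q<dX i * dH. K i j k y r * P $$ (r, q) * cnj (K i j k y' q))"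
    proof (intro sum.cong refl)
      fix k assume "k \<in> {..<dE j i}"
      then have k: "y * dE j i + k < dY j * dE j i" "y' * dE j i + k < dY j * dE j i"
        using y by (simp_all add: prod_index_less)
      show "(\<tau> i j * P * adj (\<tau> i j)) $$ (y * dE j i + k, y' * dE j i + k)
        = (\<Sum>r<dX i * dH. \<Sum>q<dX i * dH. K i j k y r * P $$ (r, q) * cnj (K i j k y' q))"
        using k by (subst mult3_index_sum[OF T P adj_carrier[OF T]]) (simp_all add: adj_index[OF T] K_def)
    qed
    finally show "M i j P $$ (y, y') = kraus_map (dY j) (dX i * dH) (dE j i) (K i j) P $$ (y, y')"
      using y by simp
  qed (simp_all add: chanM_def dil_comp_def ptrace2_def kraus_map_def)
qed

lemma t_iso:
  assumes i: "i < m" and lt: "x < dX i" "x' < dX i" "h < dH" "h' < dH"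
  shows "(\<Sum>j<n. \<Sum>y<dY j. \<Sum>k<dE j i. cnj (t i j k y x h) * t i j k y x' h') = (if x = x' \<and> h = h' then 1 else 0)"
proof -
  let ?c = "x * dH + h" and ?c' = "x' * dH + h'"
  have c: "?c < dX i * dH" "?c' < dX i * dH" using lt by (simp_all add: prod_index_less)
  have "(adj (\<tau> i j) * \<tau> i j) $$ (?c, ?c') = (\<Sum>y<dY j. \<Sum>k<dE j i. cnj (t i j k y x h) * t i j k y x' h')"
    if j: "j < n" for j
    using mult_index_sum[OF adj_carrier[OF tau_carrier[OF i j]] tau_carrier[OF i j] c] c
    by (simp add: adj_index[OF tau_carrier[OF i j]] sum_prod_index t_def K_def prod_index_less)
  then have "(\<Sum>j<n. \<Sum>y<dY j. \<Sum>k<dE j i. cnj (t i j k y x h) * t i j k y x' h')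
     = msum (dX i * dH) (dX i * dH) (\<lambda>j. adj (\<tau> i j) * \<tau> i j) n $$ (?c, ?c')"
    using c by (simp add: msum_def del: index_mult_mat(1))
  also have "\<dots> = 1\<^sub>m (dX i * dH) $$ (?c, ?c')" using tp i by (simp add: trace_pres_dil_def)
  also have "\<dots> = (if x = x' \<and> h = h' then 1 else 0)" using c lt by (simp add: prod_index_eq)
  finally show ?thesis .
qed

lemma t_indep:
  assumes "i < m" "j < n" "k < dE j i"
    and "\<And>y x h. y < dY j \<Longrightarrow> x < dX i \<Longrightarrow> h < dH \<Longrightarrow> (\<Sum>k<dE j i. c k * t i j k y x h) = 0"
  shows "c k = 0"
proof -
  have "kraus_lin_indep (dY j) (dE j i) (dX i * dH) (\<tau> i j)" using dil assms by (simp add: minimal_dilation_def)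
  then have "(\<forall>y<dY j. \<forall>col<dX i * dH. (\<Sum>k<dE j i. c k * \<tau> i j $$ (y * dE j i + k, col)) = 0) \<longrightarrow> c k = 0"
    unfolding kraus_lin_indep_def using assms(3) by blast
  then show ?thesis using assms(4) unfolding all_prod_index by (simp add: t_def K_def)
qed

text \<open>Orthonormality of the columns is trace preservation of \<open>M\<close>, so only that of
  the rows remains as a condition.\<close>

lemma unitary_U_iff:
  assumes i: "i < m"
  shows "unitary_mat (vstack (dX i * dH) (\<lambda>j. \<tau> i j) n) \<longleftrightarrow>
    (\<forall>j<n. \<forall>y<dY j. \<forall>k<dE j i. \<forall>j'<n. \<forall>y'<dY j'. \<forall>k'<dE j' i.
      (\<Sum>x<dX i. \<Sum>h<dH. t i j k y x h * cnj (t i j' k' y' x h)) = (if j = j' \<and> y = y' \<and> k = k' then 1 else 0))"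
proof -
  have if1: "(if j = j' \<and> y * dE j i + k = y' * dE j' i + k' then 1 else 0)
      = (if j = j' \<and> y = y' \<and> k = k' then 1 else (0::complex))"
    if "k < dE j i" "k' < dE j' i" for j j' y y' k k'
    using that by (auto simp: prod_index_eq)
  let ?cols = "\<forall>c<dX i * dH. \<forall>c'<dX i * dH. (\<Sum>j<n. \<Sum>r<dY j * dE j i. cnj (\<tau> i j $$ (r, c)) * \<tau> i j $$ (r, c'))
      = (if c = c' then 1 else 0)"
  let ?rows = "\<forall>j<n. \<forall>r<dY j * dE j i. \<forall>j'<n. \<forall>r'<dY j' * dE j' i.
      (\<Sum>c<dX i * dH. \<tau> i j $$ (r, c) * cnj (\<tau> i j' $$ (r', c))) = (if j = j' \<and> r = r' then 1 else 0)"
  have "unitary_mat (vstack (dX i * dH) (\<lambda>j. \<tau> i j) n) \<longleftrightarrow> ?cols \<and> ?rows"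
    by (rule unitary_vstack_iff) (rule tau_carrier[OF i])
  moreover have ?cols
    unfolding all_prod_index sum_prod_index using t_iso[OF i] by (simp add: t_def K_def prod_index_eq)
  ultimately have "unitary_mat (vstack (dX i * dH) (\<lambda>j. \<tau> i j) n) \<longleftrightarrow> ?rows" by blast
  also have "?rows \<longleftrightarrow> (\<forall>j<n. \<forall>y<dY j. \<forall>k<dE j i. \<forall>j'<n. \<forall>y'<dY j'. \<forall>k'<dE j' i.
      (\<Sum>x<dX i. \<Sum>h<dH. t i j k y x h * cnj (t i j' k' y' x h)) = (if j = j' \<and> y = y' \<and> k = k' then 1 else 0))"
    unfolding all_prod_index sum_prod_index by (simp add: if1 t_def K_def)
  finally show ?thesis .
qed

text \<open>Both halves remain as conditions here. The square roots occur in pairs and are traded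
  for the rational weights dim X_i / dim Y_j and their inverses.\<close>

lemma unitary_W_iff:
  assumes j: "j < n"
  shows "unitary_mat (hstack (dY j * dH) (\<lambda>i. complex_of_real (sqrt (real (dX i) / real (dY j))) \<cdot>\<^sub>m PT i j) m) \<longleftrightarrow>
    (\<forall>i<m. \<forall>x<dX i. \<forall>k<dE j i. \<forall>i'<m. \<forall>x'<dX i'. \<forall>k'<dE j i'.
      (\<Sum>y<dY j. \<Sum>h<dH. cnj (t i j k y x h) * t i' j k' y x' h)
        = (if i = i' \<and> x = x' \<and> k = k' then of_nat (dY j) / of_nat (dX i) else 0)) \<and>
    (\<forall>y<dY j. \<forall>h<dH. \<forall>y'<dY j. \<forall>h'<dH.
      (\<Sum>i<m. \<Sum>x<dX i. \<Sum>k<dE j i. of_nat (dX i) / of_nat (dY j) * (t i j k y x h * cnj (t i j k y' x h')))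
        = (if y = y' \<and> h = h' then 1 else 0))"
proof -
  define c where "c i = complex_of_real (sqrt (real (dX i) / real (dY j)))" for i
  have cc: "c i * c i = of_nat (dX i) / of_nat (dY j)" for i
    unfolding c_def by (simp flip: of_real_mult)
  have c0: "c i \<noteq> 0" if "i < m" for i
    using that dX_pos[OF that] dY_pos[OF j] by (simp add: c_def)
  have cn: "cnj (c i) = c i" for i by (simp add: c_def)
  have car: "c i \<cdot>\<^sub>m PT i j \<in> carrier_mat (dY j * dH) (dX i * dE j i)" for i
    using PT_carrier by simp
  have ent: "(c i \<cdot>\<^sub>m PT i j) $$ (y * dH + h, x * dE j i + k) = c i * t i j k y x h"
    if "y < dY j" "h < dH" "x < dX i" "k < dE j i" for i y h x k
    using that carrier_matD[OF PT_carrier, of i j] by (simp add: prod_index_less PT_index)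
  have if1: "(if i = i' \<and> x * dE j i + k = x' * dE j i' + k' then 1 else 0)
      = (if i = i' \<and> x = x' \<and> k = k' then 1 else (0::complex))"
    if "k < dE j i" "k' < dE j i'" for i i' x x' k k'
    using that by (auto simp: prod_index_eq)
  \<comment> \<open>For distinct columns the factor \<open>c i * c i'\<close> only has to be
    nonzero; for equal columns it is dim X_i / dim Y_j and moves to the right side inverted.\<close>
  have cols: "(\<Sum>y<dY j. \<Sum>h<dH. cnj (c i * t i j k y x h) * (c i' * t i' j k' y x' h)) = (if i = i' \<and> x = x' \<and> k = k' then 1 else 0)
    \<longleftrightarrow> (\<Sum>y<dY j. \<Sum>h<dH. cnj (t i j k y x h) * t i' j k' y x' h)
        = (if i = i' \<and> x = x' \<and> k = k' then of_nat (dY j) / of_nat (dX i) else 0)"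
    if "i < m" "i' < m" for i i' x x' k k'
  proof -
    define z where "z = (\<Sum>y<dY j. \<Sum>h<dH. cnj (t i j k y x h) * t i' j k' y x' h)"
    have "(\<Sum>y<dY j. \<Sum>h<dH. cnj (c i * t i j k y x h) * (c i' * t i' j k' y x' h)) = c i * c i' * z"
      unfolding z_def sum_distrib_left by (simp add: cn mult_ac)
    moreover have "c i * c i' * z = (if i = i' \<and> x = x' \<and> k = k' then 1 else 0)
      \<longleftrightarrow> z = (if i = i' \<and> x = x' \<and> k = k' then of_nat (dY j) / of_nat (dX i) else 0)"
    proof (cases "i = i' \<and> x = x' \<and> k = k'")
      case True
      then have e: "c i * c i' = of_nat (dX i) / of_nat (dY j)" using cc by simp
      show ?thesis unfolding e using True dX_pos[OF that(1)] dY_pos[OF j] by (simp add: field_simps)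
    next
      case False
      then have "\<not> (i = i' \<and> x = x' \<and> k = k')" by simp
      then show ?thesis using c0[OF that(1)] c0[OF that(2)] by (simp only: if_False) simp
    qed
    ultimately show ?thesis unfolding z_def by simp
  qed
  have rows: "c i * t i j k y x h * cnj (c i * t i j k y' x h') = of_nat (dX i) / of_nat (dY j) * (t i j k y x h * cnj (t i j k y' x h'))"
    for i k y x h y' h'
    unfolding cc[symmetric] by (simp add: cn mult_ac)
  show ?thesis
    unfolding unitary_hstack_iff[where d = "\<lambda>i. dX i * dE j i" and b = "\<lambda>i. c i \<cdot>\<^sub>m PT i j", OF car, unfolded c_def]
    unfolding c_def[symmetric] all_prod_index sum_prod_index
    by (simp add: ent if1 cols rows prod_index_eq del: complex_cnj_mult index_smult_mat)
qed

section \<open>From an entanglement-inverse to unitarity and to the formula for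
  \<open>N\<close>\<close>

lemma M_after_N_identity:
  assumes "ent_inverse m dX n dY dH dH M (max_ent dH) N" "\<And>j. j < n \<Longrightarrow> \<sigma> j \<in> carrier_mat (dY j) (dY j)" "j < n"
  shows "ent_comp n dY m dX dH N M \<sigma> j = \<sigma> j"
  using assms unfolding ent_inverse_def swap_max_ent Let_def by blast

lemma N_after_M_identity:
  assumes "ent_inverse m dX n dY dH dH M (max_ent dH) N" "\<And>i. i < m \<Longrightarrow> \<rho> i \<in> carrier_mat (dX i) (dX i)" "i < m"
  shows "ent_comp m dX n dY dH M N \<rho> i = \<rho> i"
  using assms unfolding ent_inverse_def ent_left_inverse_def Let_def by blast

text \<open>The scalars are read off at the entry (0, 0) of the composed Kraus operators, which
  exists because the spaces X_i and Y_j are nonzero.\<close>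

lemma inverse_kraus_pair:
  assumes inv: "ent_inverse m dX n dY dH dH M (max_ent dH) N"
    and N: "kraus_family n (\<lambda>j. dY j * dH) m dX N S L"
  shows "kraus_pair m n dH dX dY dE S t (\<lambda>j i s x y h. L j i s x (y * dH + h))
    (\<lambda>j i s k. kcomp (dY j) dH (L j i) (K i j) s k 0 0) (\<lambda>i j k s. kcomp (dX i) dH (K i j) (L j i) k s 0 0)"
proof
  have ch: "is_channel n (\<lambda>j. dY j * dH) m dX N"
    using inv by (simp add: ent_inverse_def ent_left_inverse_def)
  fix j y y' h h' assume j: "j < n" and lt: "y < dY j" "y' < dY j" "h < dH" "h' < dH"
  have "\<forall>P\<in>carrier_mat (dY j * dH) (dY j * dH). (\<Sum>i<m. mtrace (kraus_map (dX i) (dY j * dH) (S j i) (L j i) P)) = mtrace P"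
    using ch N j by (simp add: is_channel_def kraus_family_def)
  then show "(\<Sum>i<m. \<Sum>x<dX i. \<Sum>s<S j i. cnj (L j i s x (y * dH + h)) * L j i s x (y' * dH + h'))
      = (if y = y' \<and> h = h' then 1 else 0)"
    unfolding kraus_trace_preserving_iff using lt by (simp add: prod_index_less prod_index_eq)
next
  fix i i' j s k a b assume lt: "i < m" "i' < m" "j < n" "s < S j i" "k < dE j i'" "a < dX i" "b < dX i'"
  have "kcomp (dY j) dH (L j i) (K i' j) s k a b
      = (if i = i' \<and> a = b then kcomp (dY j) dH (L j i) (K i' j) s k 0 0 else 0)"
    by (rule ent_comp_scalar[OF kraus_M N dH_pos]) (use lt N_after_M_identity[OF inv] in auto)
  then show "(\<Sum>y<dY j. \<Sum>h<dH. L j i s a (y * dH + h) * t i' j k y b h)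
      = (if i = i' \<and> a = b then kcomp (dY j) dH (L j i) (K i j) s k 0 0 else 0)"
    by (auto simp: kcomp_def t_def)
next
  fix i j' j k s z y assume lt: "i < m" "j' < n" "j < n" "k < dE j' i" "s < S j i" "z < dY j'" "y < dY j"
  have "kcomp (dX i) dH (K i j') (L j i) k s z y
      = (if j' = j \<and> z = y then kcomp (dX i) dH (K i j') (L j i) k s 0 0 else 0)"
    by (rule ent_comp_scalar[OF N kraus_M dH_pos]) (use lt M_after_N_identity[OF inv] in auto)
  then show "(\<Sum>x<dX i. \<Sum>h<dH. t i j' k z x h * L j i s x (y * dH + h))
      = (if j' = j \<and> z = y then kcomp (dX i) dH (K i j) (L j i) k s 0 0 else 0)"
    by (auto simp: kcomp_def t_def)
qed (use dX_pos dY_pos t_iso t_indep in auto)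

lemma inverse_unitary:
  assumes "ent_inverse m dX n dY dH dH M (max_ent dH) N"
  shows "\<forall>i<m. unitary_mat (vstack (dX i * dH) (\<lambda>j. \<tau> i j) n)"
    and "\<forall>j<n. unitary_mat (hstack (dY j * dH) (\<lambda>i. complex_of_real (sqrt (real (dX i) / real (dY j))) \<cdot>\<^sub>m PT i j) m)"
proof -
  obtain S L where "kraus_family n (\<lambda>j. dY j * dH) m dX N S L"
    using channel_kraus assms unfolding ent_inverse_def ent_left_inverse_def by blast
  from inverse_kraus_pair[OF assms this]
  interpret kraus_pair m n dH dX dY dE S t "\<lambda>j i s x y h. L j i s x (y * dH + h)"
    "\<lambda>j i s k. kcomp (dY j) dH (L j i) (K i j) s k 0 0" "\<lambda>i j k s. kcomp (dX i) dH (K i j) (L j i) k s 0 0" .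
  show "\<forall>i<m. unitary_mat (vstack (dX i * dH) (\<lambda>j. \<tau> i j) n)"
    using unitary_U_iff t_rows by simp
  show "\<forall>j<n. unitary_mat (hstack (dY j * dH) (\<lambda>i. complex_of_real (sqrt (real (dX i) / real (dY j))) \<cdot>\<^sub>m PT i j) m)"
    using unitary_W_iff pt_cols pt_rows by simp
qed

lemma inverse_formula:
  assumes inv: "ent_inverse m dX n dY dH dH M (max_ent dH) N"
    and \<rho>: "\<forall>j<n. \<rho> j \<in> carrier_mat (dY j * dH) (dY j * dH)" and i: "i < m"
  shows "apply_map n dX N \<rho> i = msum (dX i) (dX i) (\<lambda>j. complex_of_real (real (dX i) / real (dY j)) \<cdot>\<^sub>m
      ptrace2 (dX i) (dE j i) (adj (PT i j) * \<rho> j * PT i j)) n"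
proof -
  obtain S L where N: "kraus_family n (\<lambda>j. dY j * dH) m dX N S L"
    using channel_kraus inv unfolding ent_inverse_def ent_left_inverse_def by blast
  from inverse_kraus_pair[OF inv this]
  interpret kraus_pair m n dH dX dY dE S t "\<lambda>j i s x y h. L j i s x (y * dH + h)"
    "\<lambda>j i s k. kcomp (dY j) dH (L j i) (K i j) s k 0 0" "\<lambda>i j k s. kcomp (dX i) dH (K i j) (L j i) k s 0 0" .
  have "N j i (\<rho> j) $$ (x, x') = (complex_of_real (real (dX i) / real (dY j)) \<cdot>\<^sub>m
      ptrace2 (dX i) (dE j i) (adj (PT i j) * \<rho> j * PT i j)) $$ (x, x')"
    if j: "j < n" and x: "x < dX i" "x' < dX i" for j x x'
  proof -
    let ?D = "dY j * dH" and ?c = "of_nat (dX i) / of_nat (dY j) :: complex"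
    let ?T = "\<lambda>k x r. t i j k (r div dH) x (r mod dH)"
    have \<rho>j: "\<rho> j \<in> carrier_mat ?D ?D" using \<rho> j by simp
    \<comment> \<open>The Kraus operators of \<open>N\<close> enter only through this sum, so the
      choice of the family does not affect the result.\<close>
    have g: "(\<Sum>s<S j i. L j i s x r * cnj (L j i s x' q)) = ?c * (\<Sum>k<dE j i. cnj (?T k x r) * ?T k x' q)"
      if "r < ?D" "q < ?D" for r q
    proof -
      have "r div dH < dY j" "q div dH < dY j" using that by (simp_all add: less_mult_imp_div_less)
      then show ?thesis using l_gram[of i j x "r div dH" "r mod dH" x' "q div dH" "q mod dH"] i j x dH_pos by simp
    qed
    have "N j i (\<rho> j) $$ (x, x') = (\<Sum>s<S j i. \<Sum>r<?D. \<Sum>q<?D. \<rho> j $$ (r, q) * (L j i s x r * cnj (L j i s x' q)))"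
      using N \<rho>j i j x by (simp add: kraus_family_def mult_ac)
    also have "\<dots> = (\<Sum>r<?D. \<Sum>q<?D. \<Sum>s<S j i. \<rho> j $$ (r, q) * (L j i s x r * cnj (L j i s x' q)))"
      by (rule trans[OF sum.swap sum.cong[OF refl sum.swap]])
    also have "\<dots> = (\<Sum>r<?D. \<Sum>q<?D. \<rho> j $$ (r, q) * (\<Sum>s<S j i. L j i s x r * cnj (L j i s x' q)))"
      by (simp add: sum_distrib_left)
    also have "\<dots> = (\<Sum>r<?D. \<Sum>q<?D. \<rho> j $$ (r, q) * (?c * (\<Sum>k<dE j i. cnj (?T k x r) * ?T k x' q)))"
      using g by (intro sum.cong refl) simp
    also have "\<dots> = ?c * (\<Sum>r<?D. \<Sum>q<?D. \<Sum>k<dE j i. cnj (?T k x r) * \<rho> j $$ (r, q) * ?T k x' q)"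
      unfolding sum_distrib_left by (intro sum.cong refl) (simp add: mult_ac)
    also have "(\<Sum>r<?D. \<Sum>q<?D. \<Sum>k<dE j i. cnj (?T k x r) * \<rho> j $$ (r, q) * ?T k x' q)
       = (\<Sum>k<dE j i. \<Sum>r<?D. \<Sum>q<?D. cnj (?T k x r) * \<rho> j $$ (r, q) * ?T k x' q)"
      by (rule trans[OF sum.cong[OF refl sum.swap] sum.swap])
    also have "\<dots> = (\<Sum>k<dE j i. (adj (PT i j) * \<rho> j * PT i j) $$ (x * dE j i + k, x' * dE j i + k))"
    proof (intro sum.cong refl)
      fix k assume k: "k \<in> {..<dE j i}"
      then have "x * dE j i + k < dX i * dE j i" "x' * dE j i + k < dX i * dE j i"
        using x by (simp_all add: prod_index_less)
      then show "(\<Sum>r<?D. \<Sum>q<?D. cnj (?T k x r) * \<rho> j $$ (r, q) * ?T k x' q)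
        = (adj (PT i j) * \<rho> j * PT i j) $$ (x * dE j i + k, x' * dE j i + k)"
        using k x by (subst mult3_index_sum[OF adj_carrier[OF PT_carrier] \<rho>j PT_carrier])
          (simp_all add: adj_index[OF PT_carrier] PT_index)
    qed
    finally show ?thesis using x by (simp add: ptrace2_def)
  qed
  then show ?thesis unfolding apply_map_def msum_def by (intro cong_mat refl) (auto intro!: sum.cong)
qed

section \<open>From unitarity to an entanglement-inverse\<close>

text \<open>The \<open>k\<close>-th Kraus operator of the map in the claimed formula: sqrt(dim X_i /
  dim Y_j) times the adjoint of the partially transposed \<open>k\<close>-th Kraus operator of
  \<open>M\<close>.\<close>

definition invK :: "nat \<Rightarrow> nat \<Rightarrow> nat \<Rightarrow> nat \<Rightarrow> nat \<Rightarrow> complex" where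
  "invK j i k x r = complex_of_real (sqrt (real (dX i) / real (dY j))) * cnj (t i j k (r div dH) x (r mod dH))"

text \<open>The row relations of W_j make the candidate trace preserving, its column relations
  evaluate N after M, and the row relations of U_i evaluate M after N. The normalisation of both
  compositions is a dimension count.\<close>

lemma unitary_inverse:
  assumes U: "\<forall>i<m. unitary_mat (vstack (dX i * dH) (\<lambda>j. \<tau> i j) n)"
    and W: "\<forall>j<n. unitary_mat (hstack (dY j * dH) (\<lambda>i. complex_of_real (sqrt (real (dX i) / real (dY j))) \<cdot>\<^sub>m PT i j) m)"
  shows "ent_inverse m dX n dY dH dH M (max_ent dH) (\<lambda>j i. kraus_map (dX i) (dY j * dH) (dE j i) (invK j i))"
    (is "ent_inverse _ _ _ _ _ _ _ _ ?N")
proof -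
  let ?c = "\<lambda>j i. complex_of_real (sqrt (real (dX i) / real (dY j)))"
  have N: "kraus_family n (\<lambda>j. dY j * dH) m dX ?N dE invK"
    by (simp add: kraus_family_def)
  have cc: "?c j i * ?c j i = of_nat (dX i) / of_nat (dY j)" for i j
    by (simp flip: of_real_mult)
  have rows: "(\<Sum>x<dX i. \<Sum>h<dH. t i j k y x h * cnj (t i j' k' y' x h)) = (if j = j' \<and> y = y' \<and> k = k' then 1 else 0)"
    if "i < m" "j < n" "y < dY j" "k < dE j i" "j' < n" "y' < dY j'" "k' < dE j' i" for i j y k j' y' k'
    by (rule iffD1[OF unitary_U_iff U[rule_format], rule_format]) (use that in auto)
  have cols: "(\<Sum>y<dY j. \<Sum>h<dH. cnj (t i j k y x h) * t i' j k' y x' h)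
        = (if i = i' \<and> x = x' \<and> k = k' then of_nat (dY j) / of_nat (dX i) else 0)"
    if "j < n" "i < m" "x < dX i" "k < dE j i" "i' < m" "x' < dX i'" "k' < dE j i'" for j i x k i' x' k'
    by (rule iffD1[OF unitary_W_iff W[rule_format], THEN conjunct1, rule_format]) (use that in auto)
  have ptr: "(\<Sum>i<m. \<Sum>x<dX i. \<Sum>k<dE j i. of_nat (dX i) / of_nat (dY j) * (t i j k y x h * cnj (t i j k y' x h')))
        = (if y = y' \<and> h = h' then 1 else 0)"
    if "j < n" "y < dY j" "h < dH" "y' < dY j" "h' < dH" for j y h y' h'
    by (rule iffD1[OF unitary_W_iff W[rule_format], THEN conjunct2, rule_format]) (use that in auto)
  \<comment> \<open>U_i is square: the sum of all squared moduli of its entries counts its rows and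
    also its columns.\<close>
  have dimU: "(\<Sum>j<n. of_nat (dE j i) * of_nat (dY j)) = of_nat (dX i) * (of_nat dH :: complex)" if i: "i < m" for i
  proof -
    have "(\<Sum>j<n. of_nat (dE j i) * of_nat (dY j) :: complex)
       = (\<Sum>j<n. \<Sum>y<dY j. \<Sum>k<dE j i. \<Sum>x<dX i. \<Sum>h<dH. t i j k y x h * cnj (t i j k y x h))"
      using i by (simp add: rows mult.commute)
    also have "\<dots> = (\<Sum>x<dX i. \<Sum>h<dH. \<Sum>j<n. \<Sum>y<dY j. \<Sum>k<dE j i. t i j k y x h * cnj (t i j k y x h))"
      by (rule sum_swap_nested)
    also have "\<dots> = (\<Sum>x<dX i. \<Sum>h<dH. 1)"
      using t_iso[OF i] by (intro sum.cong refl) (simp add: mult.commute)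
    finally show ?thesis by simp
  qed
  \<comment> \<open>The same count for W_j, with its weights included.\<close>
  have dimW: "(\<Sum>i<m. of_nat (dE j i) * of_nat (dX i)) = of_nat (dY j) * (of_nat dH :: complex)" if j: "j < n" for j
  proof -
    have "(\<Sum>i<m. of_nat (dE j i) * of_nat (dX i) :: complex)
       = (\<Sum>i<m. \<Sum>x<dX i. \<Sum>k<dE j i. of_nat (dX i) / of_nat (dY j) * (of_nat (dY j) / of_nat (dX i)))"
      using dX_pos dY_pos[OF j] by (intro sum.cong refl) auto
    also have "\<dots> = (\<Sum>i<m. \<Sum>x<dX i. \<Sum>k<dE j i. \<Sum>y<dY j. \<Sum>h<dH. of_nat (dX i) / of_nat (dY j) * (t i j k y x h * cnj (t i j k y x h)))"
    proof (intro sum.cong refl)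
      fix i x k assume "i \<in> {..<m}" "x \<in> {..<dX i}" "k \<in> {..<dE j i}"
      then have "(\<Sum>y<dY j. \<Sum>h<dH. t i j k y x h * cnj (t i j k y x h)) = of_nat (dY j) / of_nat (dX i)"
        using cols[of j i x k i x k] j by (simp add: mult.commute)
      then show "of_nat (dX i) / of_nat (dY j) * (of_nat (dY j) / of_nat (dX i)) =
        (\<Sum>y<dY j. \<Sum>h<dH. of_nat (dX i) / of_nat (dY j) * (t i j k y x h * cnj (t i j k y x h)))"
        by (simp only: sum_distrib_left[symmetric])
    qed
    also have "\<dots> = (\<Sum>y<dY j. \<Sum>h<dH. \<Sum>i<m. \<Sum>x<dX i. \<Sum>k<dE j i. of_nat (dX i) / of_nat (dY j) * (t i j k y x h * cnj (t i j k y x h)))"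
      by (rule sum_swap_nested)
    also have "\<dots> = (\<Sum>y<dY j. \<Sum>h<dH. 1)"
      using j by (intro sum.cong refl) (subst ptr; simp)
    finally show ?thesis by simp
  qed
  have channel: "is_channel n (\<lambda>j. dY j * dH) m dX ?N"
    unfolding is_channel_def kraus_trace_preserving_iff
  proof (intro conjI allI impI lin_map_kraus_map compl_pos_kraus_map)
    fix j r q assume j: "j < n" and r: "r < dY j * dH" and q: "q < dY j * dH"
    have "(\<Sum>i<m. \<Sum>x<dX i. \<Sum>k<dE j i. cnj (invK j i k x r) * invK j i k x q)
      = (\<Sum>i<m. \<Sum>x<dX i. \<Sum>k<dE j i. of_nat (dX i) / of_nat (dY j)
          * (t i j k (r div dH) x (r mod dH) * cnj (t i j k (q div dH) x (q mod dH))))"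
      unfolding cc[symmetric] by (simp add: invK_def mult_ac)
    also have "\<dots> = (if r div dH = q div dH \<and> r mod dH = q mod dH then 1 else 0)"
      using j r q dH_pos by (intro ptr) (simp_all add: less_mult_imp_div_less)
    also have "\<dots> = (if r = q then 1 else 0)" by (metis div_mult_mod_eq)
    finally show "(\<Sum>i<m. \<Sum>x<dX i. \<Sum>k<dE j i. cnj (invK j i k x r) * invK j i k x q) = (if r = q then 1 else 0)" .
  qed
  have left: "ent_comp m dX n dY dH M ?N \<rho> i = \<rho> i"
    if \<rho>: "\<And>i. i < m \<Longrightarrow> \<rho> i \<in> carrier_mat (dX i) (dX i)" and i: "i < m" for \<rho> i
  \<comment> \<open>The root from \<open>invK\<close> times the squared column norm dim Y_j / dim
    X_i of the partial transpose. Its square is dim Y_j / dim X_i, so the required total is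
    \<open>dimU\<close> divided by dim X_i.\<close>
  proof (rule ent_comp_identity[OF kraus_M N _ dH_pos, where c = "\<lambda>j. ?c j i * (of_nat (dY j) / of_nat (dX i))"])
    fix i' j s k a b assume lt: "i' < m" "j < n" "s < dE j i" "k < dE j i'" "a < dX i" "b < dX i'"
    have "kcomp (dY j) dH (invK j i) (K i' j) s k a b = ?c j i * (\<Sum>y<dY j. \<Sum>h<dH. cnj (t i j s y a h) * t i' j k y b h)"
      unfolding sum_distrib_left kcomp_def by (intro sum.cong refl) (simp add: invK_def t_def)
    then show "kcomp (dY j) dH (invK j i) (K i' j) s k a b
      = (if i = i' \<and> s = k \<and> a = b then ?c j i * (of_nat (dY j) / of_nat (dX i)) else 0)"
      using cols[of j i a s i' b k] lt i by auto
  next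
    have "(\<Sum>j<n. of_nat (dE j i) * (?c j i * (of_nat (dY j) / of_nat (dX i)) * cnj (?c j i * (of_nat (dY j) / of_nat (dX i)))))
      = (\<Sum>j<n. of_nat (dE j i) * of_nat (dY j) / of_nat (dX i))"
    proof (intro sum.cong refl)
      fix j assume "j \<in> {..<n}"
      then have "0 < dY j" "0 < dX i" using dY_pos dX_pos[OF i] by auto
      have "?c j i * (of_nat (dY j) / of_nat (dX i)) * cnj (?c j i * (of_nat (dY j) / of_nat (dX i)))
         = (?c j i * ?c j i) * (of_nat (dY j) / of_nat (dX i) * (of_nat (dY j) / of_nat (dX i)))"
        by (simp add: mult_ac)
      also have "\<dots> = of_nat (dY j) / of_nat (dX i)"
        unfolding cc using \<open>0 < dY j\<close> \<open>0 < dX i\<close> by simp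
      finally show "of_nat (dE j i) * (?c j i * (of_nat (dY j) / of_nat (dX i)) * cnj (?c j i * (of_nat (dY j) / of_nat (dX i))))
        = of_nat (dE j i) * of_nat (dY j) / of_nat (dX i)" by simp
    qed
    then show "(\<Sum>j<n. of_nat (dE j i) * (?c j i * (of_nat (dY j) / of_nat (dX i)) * cnj (?c j i * (of_nat (dY j) / of_nat (dX i)))))
      = of_nat dH" using dimU[OF i] dX_pos[OF i] by (simp flip: sum_divide_distrib)
  qed (use that in auto)
  have right: "ent_comp n dY m dX dH ?N M \<sigma> j = \<sigma> j"
    if \<sigma>: "\<And>j. j < n \<Longrightarrow> \<sigma> j \<in> carrier_mat (dY j) (dY j)" and j: "j < n" for \<sigma> j
  \<comment> \<open>The rows of U_i have norm 1, so only the root from \<open>invK\<close> is left;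
    the required total is \<open>dimW\<close> divided by dim Y_j.\<close>
  proof (rule ent_comp_identity[OF N kraus_M _ dH_pos, where c = "\<lambda>i. ?c j i"])
    fix j' i s k a b assume lt: "j' < n" "i < m" "s < dE j i" "k < dE j' i" "a < dY j" "b < dY j'"
    have "kcomp (dX i) dH (K i j) (invK j' i) s k a b = ?c j' i * (\<Sum>x<dX i. \<Sum>h<dH. t i j s a x h * cnj (t i j' k b x h))"
      unfolding sum_distrib_left kcomp_def by (intro sum.cong refl) (simp add: invK_def t_def)
    then show "kcomp (dX i) dH (K i j) (invK j' i) s k a b = (if j = j' \<and> s = k \<and> a = b then ?c j i else 0)"
      using rows[of i j a s j' b k] lt j by auto
  next
    have "(\<Sum>i<m. of_nat (dE j i) * (?c j i * cnj (?c j i))) = (\<Sum>i<m. of_nat (dE j i) * of_nat (dX i) / of_nat (dY j))"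
      unfolding complex_cnj_complex_of_real cc by simp
    then show "(\<Sum>i<m. of_nat (dE j i) * (?c j i * cnj (?c j i))) = of_nat dH"
      using dimW[OF j] dY_pos[OF j] by (simp flip: sum_divide_distrib)
  qed (use that in auto)
  show ?thesis
    unfolding ent_inverse_def ent_left_inverse_def swap_max_ent Let_def using channel left right by blast
qed

end

text \<open>Uniqueness is expressed by the formula: every entanglement-inverse has the prescribed
  values on all of B tensor B(H). Equality of the functions \<open>N\<close> themselves would be too
  strong, since their values outside the relevant carriers and indices are unconstrained.\<close>

theorem mainTheorem1:
  fixes m n dH :: nat and dX dY :: "nat \<Rightarrow> nat" and dE :: "nat \<Rightarrow> nat \<Rightarrow> nat"
    and \<tau> :: "nat \<Rightarrow> nat \<Rightarrow> complex mat"
  assumes dX_pos: "\<forall>i<m. dX i > 0"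
    and dY_pos: "\<forall>j<n. dY j > 0"
    and dH_pos: "dH > 0"
    and dil: "minimal_dilation m dX n dY dH dE \<tau>"
    and tp: "trace_pres_dil m dX n dH \<tau>"
  shows "(ent_invertible m dX n dY dH dH (chanM dY dE \<tau>) (max_ent dH) \<longleftrightarrow>
      ((\<forall>i<m. unitary_mat (vstack (dX i * dH) (\<lambda>j. \<tau> i j) n)) \<and>
       (\<forall>j<n. unitary_mat (hstack (dY j * dH)
          (\<lambda>i. complex_of_real (sqrt (real (dX i) / real (dY j)))
                 \<cdot>\<^sub>m ptransp (dX i) (dY j) dH (dE j i) (\<tau> i j)) m))))
    \<and> (ent_invertible m dX n dY dH dH (chanM dY dE \<tau>) (max_ent dH) \<longrightarrow>
      (\<forall>N. ent_inverse m dX n dY dH dH (chanM dY dE \<tau>) (max_ent dH) N \<longrightarrow>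
        (\<forall>\<rho>. (\<forall>j<n. \<rho> j \<in> carrier_mat (dY j * dH) (dY j * dH)) \<longrightarrow>
          (\<forall>i<m. apply_map n dX N \<rho> i =
             msum (dX i) (dX i)
               (\<lambda>j. complex_of_real (real (dX i) / real (dY j)) \<cdot>\<^sub>m
                  ptrace2 (dX i) (dE j i)
                    (adj (ptransp (dX i) (dY j) dH (dE j i) (\<tau> i j)) * \<rho> j
                       * ptransp (dX i) (dY j) dH (dE j i) (\<tau> i j))) n))))"
proof -
  interpret dilation m n dH dX dY dE \<tau>
    by standard (use assms in auto)
  show ?thesis
    unfolding ent_invertible_def using inverse_unitary unitary_inverse inverse_formula by blast
qed

end
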